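(* Let $S/R$ be a Galois extension of commutative rings whose Galois group $G$ is a finite abelian group of odd order. If $S/R$ has a normal basis, then it has a self-dual normal basis.
   Context: For a commutative ring $S$, a finite group $G$ of automorphisms of $S$ and $R = S^G$, write $s^g$ for the image of $s\in S$ under $g\in G$, with the convention $(s^g)^h = s^{gh}$. Let $S^{(G)} = \mathrm{Map}(G,S)$ be the ring of all functions $G \to S$ with pointwise operations. The extension $S/R$ is called Galois (with Galois group $G$) if the ring homomorphism $\phi : S\otimes_R S \to S^{(G)}$, $\phi(s_1\otimes s_2)(g) = s_1 s_2^g$, is surjective (it is then an isomorphism). A normal basis of $S$ over $R$ is an $R$-basis of $S$ of the form $(s^g)_{g\in G}$ for some $s \in S$. The trace map is $tr : S\to R$, $tr(s) = \sum_{g\in G} s^g$. A normal basis $(s^g)_{g\in G}$ is self-dual if it is self-dual with respect to the trace form $(x,y)\mapsto tr(xy)$, i.e. $tr(s^g s^h) = 1$ if $g=h$ and $0$ if $g\ne h$. *)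

theory Defs
  imports
    "HOL-Algebra.Bij"
    "HOL-Algebra.Free_Abelian_Groups"
    "HOL-Algebra.Generated_Groups"
    "HOL-Algebra.QuotRing"
begin

section \<open>Automorphism groups of rings and invariants\<close>

definition ring_auto :: "('a, 'b) ring_scheme \<Rightarrow> ('a \<Rightarrow> 'a) set"
  where "ring_auto S = ring_hom S S \<inter> Bij (carrier S)"

text \<open>
  The image \<open>s\<^sup>g\<close> of \<open>s\<close> under \<open>g\<close> is \<open>g s\<close>. The product of \<open>g\<close> and \<open>h\<close> in \<open>ring_aut_group S\<close> is
  \<open>g\<close> after \<open>h\<close>. The convention \<open>(s\<^sup>g)\<^sup>h = s\<^sup>g\<^sup>h\<close> for exponents yields the opposite group on the
  same set of automorphisms, which has the same subgroups, and a subgroup is commutative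
  for one convention iff it is for the other.
\<close>

definition ring_aut_group :: "('a, 'b) ring_scheme \<Rightarrow> ('a \<Rightarrow> 'a) monoid"
  where "ring_aut_group S = BijGroup (carrier S) \<lparr>carrier := ring_auto S\<rparr>"

definition fixed_ring :: "('a, 'b) ring_scheme \<Rightarrow> ('a \<Rightarrow> 'a) set \<Rightarrow> 'a set"
  where "fixed_ring S G = {x \<in> carrier S. \<forall>g\<in>G. g x = x}"


section \<open>The tensor product of a commutative ring with itself over a subring\<close>

text \<open>
  \<open>S \<otimes>\<^sub>R S\<close> is the free abelian group on \<open>S \<times> S\<close> modulo the subgroup generated by the
  usual relators. Only its additive group is constructed: the ring structure plays no role in
  the surjectivity of a map defined on it.
\<close>

definition tensor_relators :: "('a, 'b) ring_scheme \<Rightarrow> 'a set \<Rightarrow> ('a \<times> 'a \<Rightarrow>\<^sub>0 int) set"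
  where "tensor_relators S R =
    {frag_of (a \<oplus>\<^bsub>S\<^esub> a', b) - frag_of (a, b) - frag_of (a', b) | a a' b.
       a \<in> carrier S \<and> a' \<in> carrier S \<and> b \<in> carrier S} \<union>
    {frag_of (a, b \<oplus>\<^bsub>S\<^esub> b') - frag_of (a, b) - frag_of (a, b') | a b b'.
       a \<in> carrier S \<and> b \<in> carrier S \<and> b' \<in> carrier S} \<union>
    {frag_of (a \<otimes>\<^bsub>S\<^esub> r, b) - frag_of (a, r \<otimes>\<^bsub>S\<^esub> b) | a r b.
       a \<in> carrier S \<and> r \<in> R \<and> b \<in> carrier S}"

definition tensor_kernel :: "('a, 'b) ring_scheme \<Rightarrow> 'a set \<Rightarrow> ('a \<times> 'a \<Rightarrow>\<^sub>0 int) set"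
  where "tensor_kernel S R =
    generate (free_Abelian_group (carrier S \<times> carrier S)) (tensor_relators S R)"

definition tensor_square :: "('a, 'b) ring_scheme \<Rightarrow> 'a set \<Rightarrow> ('a \<times> 'a \<Rightarrow>\<^sub>0 int) set monoid"
  where "tensor_square S R =
    free_Abelian_group (carrier S \<times> carrier S) Mod tensor_kernel S R"

definition pure_tensor ::
    "('a, 'b) ring_scheme \<Rightarrow> 'a set \<Rightarrow> 'a \<Rightarrow> 'a \<Rightarrow> ('a \<times> 'a \<Rightarrow>\<^sub>0 int) set"
  where "pure_tensor S R a b =
    tensor_kernel S R #>\<^bsub>free_Abelian_group (carrier S \<times> carrier S)\<^esub> frag_of (a, b)"


section \<open>Galois extensions\<close>

definition galois_map_free ::
    "('a, 'b) ring_scheme \<Rightarrow> ('a \<Rightarrow> 'a) set \<Rightarrow> ('a \<times> 'a \<Rightarrow>\<^sub>0 int) \<Rightarrow> ('a \<Rightarrow> 'a) \<Rightarrow> 'a"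
  where "galois_map_free S G c =
    (\<lambda>g\<in>G. \<Oplus>\<^bsub>S\<^esub>p\<in>Poly_Mapping.keys c.
        [Poly_Mapping.lookup c p] \<cdot>\<^bsub>S\<^esub> (fst p \<otimes>\<^bsub>S\<^esub> g (snd p)))"

text \<open>
  The map induced on cosets; it is well defined and determined by
  \<open>a \<otimes> b \<mapsto> (\<lambda>g\<in>G. a \<otimes>\<^bsub>S\<^esub> g b)\<close>, see \<open>galois_map_hom\<close> and
  \<open>galois_map_pure_tensor\<close> below.
\<close>

definition galois_map ::
    "('a, 'b) ring_scheme \<Rightarrow> ('a \<Rightarrow> 'a) set \<Rightarrow> ('a \<times> 'a \<Rightarrow>\<^sub>0 int) set \<Rightarrow> ('a \<Rightarrow> 'a) \<Rightarrow> 'a"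
  where "galois_map S G T = the_elem (galois_map_free S G ` T)"

definition galois_extension ::
    "('a, 'b) ring_scheme \<Rightarrow> 'a set \<Rightarrow> ('a \<Rightarrow> 'a) set \<Rightarrow> bool"
  where "galois_extension S R G \<longleftrightarrow>
    cring S \<and> finite G \<and> subgroup G (ring_aut_group S) \<and> R = fixed_ring S G \<and>
    galois_map S G ` carrier (tensor_square S R) = (G \<rightarrow>\<^sub>E carrier S)"


section \<open>Normal bases and self-duality\<close>

definition is_basis ::
    "('a, 'b) ring_scheme \<Rightarrow> 'a set \<Rightarrow> 'i set \<Rightarrow> ('i \<Rightarrow> 'a) \<Rightarrow> bool"
  where "is_basis S R I b \<longleftrightarrow>
    b \<in> I \<rightarrow> carrier S \<and>
    (\<forall>x\<in>carrier S. \<exists>c\<in>I \<rightarrow> R. x = (\<Oplus>\<^bsub>S\<^esub>i\<in>I. c i \<otimes>\<^bsub>S\<^esub> b i)) \<and>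
    (\<forall>c\<in>I \<rightarrow> R. (\<Oplus>\<^bsub>S\<^esub>i\<in>I. c i \<otimes>\<^bsub>S\<^esub> b i) = \<zero>\<^bsub>S\<^esub> \<longrightarrow> (\<forall>i\<in>I. c i = \<zero>\<^bsub>S\<^esub>))"
  \<comment> \<open>for finite \<open>I\<close>; \<open>finsum\<close> over an infinite index set is zero\<close>

definition generates_normal_basis ::
    "('a, 'b) ring_scheme \<Rightarrow> 'a set \<Rightarrow> ('a \<Rightarrow> 'a) set \<Rightarrow> 'a \<Rightarrow> bool"
  where "generates_normal_basis S R G s \<longleftrightarrow> s \<in> carrier S \<and> is_basis S R G (\<lambda>g. g s)"

definition galois_trace :: "('a, 'b) ring_scheme \<Rightarrow> ('a \<Rightarrow> 'a) set \<Rightarrow> 'a \<Rightarrow> 'a"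
  where "galois_trace S G x = (\<Oplus>\<^bsub>S\<^esub>g\<in>G. g x)"

definition generates_self_dual_normal_basis ::
    "('a, 'b) ring_scheme \<Rightarrow> 'a set \<Rightarrow> ('a \<Rightarrow> 'a) set \<Rightarrow> 'a \<Rightarrow> bool"
  where "generates_self_dual_normal_basis S R G s \<longleftrightarrow>
    generates_normal_basis S R G s \<and>
    (\<forall>g\<in>G. \<forall>h\<in>G. galois_trace S G (g s \<otimes>\<^bsub>S\<^esub> h s) = (if g = h then \<one>\<^bsub>S\<^esub> else \<zero>\<^bsub>S\<^esub>))"


section \<open>The definitions behave as intended\<close>

lemma ring_auto_closed: "g \<in> ring_auto S \<Longrightarrow> x \<in> carrier S \<Longrightarrow> g x \<in> carrier S"
  by (auto simp: ring_auto_def ring_hom_def)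

lemma (in ring) subgroup_ring_auto: "subgroup (ring_auto R) (BijGroup (carrier R))"
proof (rule subgroup.intro)
  show "ring_auto R \<subseteq> carrier (BijGroup (carrier R))"
    by (force simp add: ring_auto_def BijGroup_def)
next
  fix x y
  assume xy: "x \<in> ring_auto R" "y \<in> ring_auto R"
  have "compose (carrier R) x y \<in> ring_hom R R"
    using xy by (auto simp: ring_auto_def ring_hom_def compose_def Pi_iff)
  moreover have "compose (carrier R) x y \<in> Bij (carrier R)"
    using xy by (auto simp: ring_auto_def intro: compose_Bij)
  ultimately show "x \<otimes>\<^bsub>BijGroup (carrier R)\<^esub> y \<in> ring_auto R"
    using xy by (simp add: BijGroup_def ring_auto_def)
next
  show "\<one>\<^bsub>BijGroup (carrier R)\<^esub> \<in> ring_auto R"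
    by (auto simp: BijGroup_def ring_auto_def id_Bij ring_hom_def)
next
  fix x
  assume x: "x \<in> ring_auto R"
  let ?y = "restrict (inv_into (carrier R) x) (carrier R)"
  have B: "x \<in> Bij (carrier R)" and H: "x \<in> ring_hom R R"
    using x by (auto simp: ring_auto_def)
  have "?y \<in> ring_hom R R"
  proof (rule ring_hom_memI)
    fix a assume "a \<in> carrier R"
    then show "?y a \<in> carrier R"
      using B by (simp add: Bij_inv_into_mem)
  next
    fix a b assume ab: "a \<in> carrier R" "b \<in> carrier R"
    show "?y (a \<otimes> b) = ?y a \<otimes> ?y b"
      using ab H Bij_inv_into_lemma[of "carrier R" x "(\<otimes>)", OF _ B _ ab]
      by (simp add: ring_hom_mult Pi_iff)
    show "?y (a \<oplus> b) = ?y a \<oplus> ?y b"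
      using ab H Bij_inv_into_lemma[of "carrier R" x "(\<oplus>)", OF _ B _ ab]
      by (simp add: ring_hom_add Pi_iff)
  next
    have "inj_on x (carrier R)" using B by (auto simp: Bij_def bij_betw_def)
    then have "inv_into (carrier R) x (x \<one>) = \<one>" by simp
    then show "?y \<one> = \<one>" using H by (simp add: ring_hom_one)
  qed
  then show "inv\<^bsub>BijGroup (carrier R)\<^esub> x \<in> ring_auto R"
    using B by (simp del: restrict_apply add: inv_BijGroup ring_auto_def restrict_inv_into_Bij)
qed

lemma (in ring) group_ring_aut_group: "group (ring_aut_group R)"
  by (simp add: ring_aut_group_def subgroup.subgroup_is_group subgroup_ring_auto group_BijGroup)

lemma subgroup_ring_aut_group_subset: "subgroup G (ring_aut_group S) \<Longrightarrow> G \<subseteq> ring_auto S"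
  using subgroup.subset by (fastforce simp: ring_aut_group_def)

lemma tensor_relators_subset:
  assumes "cring S" "R \<subseteq> carrier S"
  shows "tensor_relators S R \<subseteq> carrier (free_Abelian_group (carrier S \<times> carrier S))"
proof -
  interpret cring S by fact
  have diff: "Poly_Mapping.keys (p - q) \<subseteq> A"
    if "Poly_Mapping.keys p \<subseteq> A" "Poly_Mapping.keys q \<subseteq> A"
    for p q :: "'a \<times> 'a \<Rightarrow>\<^sub>0 int" and A
    using that keys_diff[of p q] by blast
  show ?thesis
  proof
    fix x assume "x \<in> tensor_relators S R"
    then show "x \<in> carrier (free_Abelian_group (carrier S \<times> carrier S))"
      unfolding tensor_relators_def carrier_free_Abelian_group_iff
      by (elim UnE CollectE exE conjE; hypsubst; intro diff)
        (use assms(2) in \<open>simp_all add: subset_iff\<close>)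
  qed
qed

lemma normal_tensor_kernel:
  assumes "cring S" "R \<subseteq> carrier S"
  shows "tensor_kernel S R \<lhd> free_Abelian_group (carrier S \<times> carrier S)"
  unfolding tensor_kernel_def
  by (rule comm_group.subgroup_imp_normal[OF abelian_free_Abelian_group
        group.generate_is_subgroup[OF group_free_Abelian_group tensor_relators_subset[OF assms]]])

lemma comm_group_tensor_square:
  assumes "cring S" "R \<subseteq> carrier S"
  shows "comm_group (tensor_square S R)"
  unfolding tensor_square_def
  by (rule comm_group.abelian_FactGroup[OF abelian_free_Abelian_group
        normal_imp_subgroup[OF normal_tensor_kernel[OF assms]]])

context
  fixes S :: "('a, 'b) ring_scheme" (structure) and G :: "('a \<Rightarrow> 'a) set"
  assumes cring: "cring S" and G: "G \<subseteq> ring_auto S"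
begin

interpretation cring S by (rule cring)

private lemma G_closed: "g \<in> G \<Longrightarrow> x \<in> carrier S \<Longrightarrow> g x \<in> carrier S"
  by (rule ring_auto_closed[OF subsetD[OF G]])

lemma galois_map_free_superset:
  assumes "Poly_Mapping.keys c \<subseteq> A" "finite A" "A \<subseteq> carrier S \<times> carrier S" "g \<in> G"
  shows "galois_map_free S G c g =
    (\<Oplus>p\<in>A. [Poly_Mapping.lookup c p] \<cdot> (fst p \<otimes> g (snd p)))"
  unfolding galois_map_free_def restrict_apply if_P[OF assms(4)]
proof (rule add.finprod_mono_neutral_cong_left)
  show "[Poly_Mapping.lookup c p] \<cdot> (fst p \<otimes> g (snd p)) = \<zero>"
    if "p \<in> A - Poly_Mapping.keys c" for p
    using that by (simp add: in_keys_iff add_pow_def)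
  show "(\<lambda>p. [Poly_Mapping.lookup c p] \<cdot> (fst p \<otimes> g (snd p))) \<in> A \<rightarrow> carrier S"
    using assms G_closed by auto
qed (use assms in auto)

lemma galois_map_free_hom:
  "galois_map_free S G
    \<in> hom (free_Abelian_group (carrier S \<times> carrier S)) (product_group G (\<lambda>_. add_monoid S))"
proof (rule homI)
  fix c assume c: "c \<in> carrier (free_Abelian_group (carrier S \<times> carrier S))"
  have "(\<Oplus>p\<in>Poly_Mapping.keys c. [Poly_Mapping.lookup c p] \<cdot> (fst p \<otimes> g (snd p))) \<in> carrier S"
    if "g \<in> G" for g
    using c G_closed[OF that] by (intro finsum_closed) (auto simp: subset_iff)
  then show "galois_map_free S G c \<in> carrier (product_group G (\<lambda>_. add_monoid S))"
    by (simp add: galois_map_free_def)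
next
  fix c d
  assume cd: "c \<in> carrier (free_Abelian_group (carrier S \<times> carrier S))"
    "d \<in> carrier (free_Abelian_group (carrier S \<times> carrier S))"
  define A where "A = Poly_Mapping.keys c \<union> Poly_Mapping.keys d"
  have A: "finite A" "A \<subseteq> carrier S \<times> carrier S" "Poly_Mapping.keys c \<subseteq> A"
    "Poly_Mapping.keys d \<subseteq> A" "Poly_Mapping.keys (c + d) \<subseteq> A"
    using cd keys_add[of c d] by (auto simp: A_def)
  have "galois_map_free S G (c + d) g = galois_map_free S G c g \<oplus> galois_map_free S G d g"
    if g: "g \<in> G" for g
  proof -
    have m: "fst p \<otimes> g (snd p) \<in> carrier S" if "p \<in> A" for p
      using that A(2) G_closed[OF g] by auto
    have "galois_map_free S G (c + d) g =
        (\<Oplus>p\<in>A. [Poly_Mapping.lookup c p] \<cdot> (fst p \<otimes> g (snd p)) \<oplus>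
              [Poly_Mapping.lookup d p] \<cdot> (fst p \<otimes> g (snd p)))"
      unfolding galois_map_free_superset[OF A(5,1,2) g]
      using m by (intro finsum_cong') (auto simp: lookup_add add.int_pow_mult)
    also have "\<dots> = galois_map_free S G c g \<oplus> galois_map_free S G d g"
      unfolding galois_map_free_superset[OF A(3,1,2) g] galois_map_free_superset[OF A(4,1,2) g]
      using m by (intro finsum_addf) auto
    finally show ?thesis .
  qed
  then show "galois_map_free S G (c \<otimes>\<^bsub>free_Abelian_group (carrier S \<times> carrier S)\<^esub> d) =
      galois_map_free S G c \<otimes>\<^bsub>product_group G (\<lambda>_. add_monoid S)\<^esub> galois_map_free S G d"
    by (intro ext) (simp add: free_Abelian_group_def galois_map_free_def)
qed

lemma galois_map_free_frag_of:
  assumes "a \<in> carrier S" "b \<in> carrier S"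
  shows "galois_map_free S G (frag_of (a, b)) = (\<lambda>g\<in>G. a \<otimes> g b)"
proof
  fix g
  show "galois_map_free S G (frag_of (a, b)) g = (\<lambda>g\<in>G. a \<otimes> g b) g"
  proof (cases "g \<in> G")
    case True
    have "galois_map_free S G (frag_of (a, b)) g = [(1::int)] \<cdot> (a \<otimes> g b)"
      unfolding galois_map_free_def using True assms G_closed[OF True assms(2)]
      by (simp add: add.finprod_singleton)
    also have "\<dots> = a \<otimes> g b"
      using assms G_closed[OF True assms(2)] by (intro add.int_pow_1 m_closed)
    finally show ?thesis using True by simp
  qed (simp add: galois_map_free_def)
qed

private lemma group_maps: "group (product_group G (\<lambda>_. add_monoid S))"
  by (simp add: a_group)

lemma galois_map_free_kernel:
  assumes c: "c \<in> tensor_kernel S (fixed_ring S G)"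
  shows "galois_map_free S G c = (\<lambda>g\<in>G. \<zero>)"
proof -
  let ?F = "free_Abelian_group (carrier S \<times> carrier S)"
  let ?M = "product_group G (\<lambda>_. add_monoid S)"
  interpret h: group_hom ?F ?M "galois_map_free S G"
    using galois_map_free_hom group_maps by (simp add: group_hom_def group_hom_axioms_def)
  have R: "fixed_ring S G \<subseteq> carrier S"
    by (auto simp: fixed_ring_def)
  have sub: "tensor_relators S (fixed_ring S G) \<subseteq> carrier ?F"
    by (rule tensor_relators_subset[OF cring R])
  have closed: "galois_map_free S G x g \<in> carrier S" if "x \<in> carrier ?F" "g \<in> G" for x g
    using h.hom_closed[OF that(1)] that(2) by (simp add: PiE_iff)
  have diff_closed: "x - y \<in> carrier ?F" if "x \<in> carrier ?F" "y \<in> carrier ?F" for x y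
    using that keys_diff[of x y] unfolding carrier_free_Abelian_group_iff by blast
  have diff: "galois_map_free S G (x - y) g = galois_map_free S G x g \<ominus> galois_map_free S G y g"
    if "x \<in> carrier ?F" "y \<in> carrier ?F" "g \<in> G" for x y g
  proof -
    have xy: "x - y \<in> carrier ?F"
      using that(1,2) by (rule diff_closed)
    have "(x - y) \<otimes>\<^bsub>?F\<^esub> y = x"
      by (simp add: free_Abelian_group_def)
    then have "galois_map_free S G x = galois_map_free S G (x - y) \<otimes>\<^bsub>?M\<^esub> galois_map_free S G y"
      using h.hom_mult[OF xy that(2)] by simp
    then have "galois_map_free S G x g = galois_map_free S G (x - y) g \<oplus> galois_map_free S G y g"
      using that(3) by simp
    then show ?thesis
      using closed[OF xy that(3)] closed[OF that(2,3)] by (simp add: minus_eq a_assoc r_neg)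
  qed
  have frag: "frag_of (a, b) \<in> carrier ?F" if "a \<in> carrier S" "b \<in> carrier S" for a b
    using that by simp
  have rel: "galois_map_free S G x = (\<lambda>g\<in>G. \<zero>)" if "x \<in> tensor_relators S (fixed_ring S G)" for x
  proof
    fix g
    show "galois_map_free S G x g = (\<lambda>g\<in>G. \<zero>) g"
    proof (cases "g \<in> G")
      case False
      then show ?thesis by (simp add: galois_map_free_def)
    next
      case g: True
      then have hom: "g \<in> ring_hom S S"
        using G by (auto simp: ring_auto_def)
      have val: "galois_map_free S G (frag_of (a, b)) g = a \<otimes> g b"
        if "a \<in> carrier S" "b \<in> carrier S" for a b
        using that g by (simp add: galois_map_free_frag_of)
      from that have "galois_map_free S G x g = \<zero>"
        unfolding tensor_relators_def
      proof (elim UnE CollectE exE conjE)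
        fix a a' b
        assume left: "a \<in> carrier S" "a' \<in> carrier S" "b \<in> carrier S"
          "x = frag_of (a \<oplus> a', b) - frag_of (a, b) - frag_of (a', b)"
        have "galois_map_free S G x g = (a \<oplus> a') \<otimes> g b \<ominus> a \<otimes> g b \<ominus> a' \<otimes> g b"
          unfolding left(4) using left(1-3) g by (simp add: diff diff_closed frag val del: carrier_free_Abelian_group_iff)
        also have "\<dots> = \<zero>"
          using left(1,2) G_closed[OF g left(3)] by algebra
        finally show ?thesis .
      next
        fix a b b'
        assume right: "a \<in> carrier S" "b \<in> carrier S" "b' \<in> carrier S"
          "x = frag_of (a, b \<oplus> b') - frag_of (a, b) - frag_of (a, b')"
        have "galois_map_free S G x g = a \<otimes> (g b \<oplus> g b') \<ominus> a \<otimes> g b \<ominus> a \<otimes> g b'"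
          unfolding right(4) ring_hom_add[OF hom right(2,3), symmetric]
          using right(1-3) g by (simp add: diff diff_closed frag val del: carrier_free_Abelian_group_iff)
        also have "\<dots> = \<zero>"
          using right(1) G_closed[OF g right(2)] G_closed[OF g right(3)] by algebra
        finally show ?thesis .
      next
        fix a r b
        assume mid: "a \<in> carrier S" "r \<in> fixed_ring S G" "b \<in> carrier S"
          "x = frag_of (a \<otimes> r, b) - frag_of (a, r \<otimes> b)"
        then have r: "r \<in> carrier S" "g r = r"
          using g by (auto simp: fixed_ring_def)
        have "g (r \<otimes> b) = r \<otimes> g b"
          using ring_hom_mult[OF hom r(1) mid(3)] r(2) by simp
        then have "galois_map_free S G x g = a \<otimes> r \<otimes> g b \<ominus> a \<otimes> (r \<otimes> g b)"
          unfolding mid(4)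
          using mid(1,3) r(1) g by (simp add: diff diff_closed frag val del: carrier_free_Abelian_group_iff)
        also have "\<dots> = \<zero>"
          using mid(1) r(1) G_closed[OF g mid(3)] by algebra
        finally show ?thesis .
      qed
      then show ?thesis using g by simp
    qed
  qed
  have "tensor_kernel S (fixed_ring S G) \<subseteq> kernel ?F ?M (galois_map_free S G)"
    unfolding tensor_kernel_def
    by (rule group.generate_subgroup_incl[OF group_free_Abelian_group _ h.subgroup_kernel])
      (use sub rel in \<open>simp add: kernel_def subset_iff del: carrier_free_Abelian_group_iff\<close>)
  with c show ?thesis by (auto simp: kernel_def)
qed

lemma galois_map_coset:
  assumes c: "c \<in> carrier (free_Abelian_group (carrier S \<times> carrier S))"
  shows "galois_map S G
      (tensor_kernel S (fixed_ring S G) #>\<^bsub>free_Abelian_group (carrier S \<times> carrier S)\<^esub> c) =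
    galois_map_free S G c"
proof -
  let ?F = "free_Abelian_group (carrier S \<times> carrier S)"
  let ?K = "tensor_kernel S (fixed_ring S G)"
  let ?M = "product_group G (\<lambda>_. add_monoid S)"
  interpret h: group_hom ?F ?M "galois_map_free S G"
    using galois_map_free_hom group_maps by (simp add: group_hom_def group_hom_axioms_def)
  interpret K: normal ?K ?F
    by (rule normal_tensor_kernel[OF cring]) (auto simp: fixed_ring_def)
  have "galois_map_free S G x = galois_map_free S G c" if "x \<in> ?K #>\<^bsub>?F\<^esub> c" for x
  proof -
    from that obtain k where k: "k \<in> ?K" "x = k \<otimes>\<^bsub>?F\<^esub> c"
      by (auto simp: r_coset_def)
    have "galois_map_free S G x = galois_map_free S G k \<otimes>\<^bsub>?M\<^esub> galois_map_free S G c"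
      unfolding k(2) using K.mem_carrier[OF k(1)] c by (rule h.hom_mult)
    also have "galois_map_free S G k = \<one>\<^bsub>?M\<^esub>"
      using galois_map_free_kernel[OF k(1)] by simp
    also have "\<one>\<^bsub>?M\<^esub> \<otimes>\<^bsub>?M\<^esub> galois_map_free S G c = galois_map_free S G c"
      by (rule h.H.l_one[OF h.hom_closed[OF c]])
    finally show ?thesis .
  qed
  moreover have "c \<in> ?K #>\<^bsub>?F\<^esub> c"
    by (rule group.rcos_self[OF group_free_Abelian_group c K.subgroup_axioms])
  ultimately have "galois_map_free S G ` (?K #>\<^bsub>?F\<^esub> c) = {galois_map_free S G c}"
    by blast
  then show ?thesis by (simp add: galois_map_def)
qed

theorem galois_map_pure_tensor:
  assumes "a \<in> carrier S" "b \<in> carrier S"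
  shows "galois_map S G (pure_tensor S (fixed_ring S G) a b) = (\<lambda>g\<in>G. a \<otimes> g b)"
  using assms galois_map_coset[of "frag_of (a, b)"]
  by (simp add: pure_tensor_def galois_map_free_frag_of)

theorem galois_map_hom:
  "galois_map S G
    \<in> hom (tensor_square S (fixed_ring S G)) (product_group G (\<lambda>_. add_monoid S))"
proof (rule homI)
  let ?F = "free_Abelian_group (carrier S \<times> carrier S)"
  let ?K = "tensor_kernel S (fixed_ring S G)"
  let ?M = "product_group G (\<lambda>_. add_monoid S)"
  interpret h: group_hom ?F ?M "galois_map_free S G"
    using galois_map_free_hom group_maps by (simp add: group_hom_def group_hom_axioms_def)
  interpret K: normal ?K ?F
    by (rule normal_tensor_kernel[OF cring]) (auto simp: fixed_ring_def)
  fix T assume "T \<in> carrier (tensor_square S (fixed_ring S G))"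
  then obtain c where c: "c \<in> carrier ?F" "T = ?K #>\<^bsub>?F\<^esub> c"
    by (auto simp: tensor_square_def FactGroup_def RCOSETS_def)
  then show "galois_map S G T \<in> carrier ?M"
    using galois_map_coset[OF c(1)] h.hom_closed[OF c(1)] by simp
  fix U assume "U \<in> carrier (tensor_square S (fixed_ring S G))"
  then obtain d where d: "d \<in> carrier ?F" "U = ?K #>\<^bsub>?F\<^esub> d"
    by (auto simp: tensor_square_def FactGroup_def RCOSETS_def)
  have TU: "T \<otimes>\<^bsub>tensor_square S (fixed_ring S G)\<^esub> U = ?K #>\<^bsub>?F\<^esub> (c \<otimes>\<^bsub>?F\<^esub> d)"
    unfolding c(2) d(2) using K.rcos_sum[OF c(1) d(1)] by (simp add: tensor_square_def FactGroup_def)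
  show "galois_map S G (T \<otimes>\<^bsub>tensor_square S (fixed_ring S G)\<^esub> U) =
      galois_map S G T \<otimes>\<^bsub>?M\<^esub> galois_map S G U"
    unfolding TU unfolding c(2) d(2) galois_map_coset[OF c(1)] galois_map_coset[OF d(1)]
      galois_map_coset[OF h.G.m_closed[OF c(1) d(1)]]
    by (rule h.hom_mult[OF c(1) d(1)])
qed

end

end

theory Submission
  imports Defs "HOL-Algebra.Multiplicative_Group"
begin

text \<open>
  Surjectivity of the Galois map, expressed in the normal basis generated by \<open>s\<close>, says that the
  resolvent \<open>r = \<Sum>g. s\<^sup>g g\<^sup>-\<^sup>1\<close> is a unit of the group ring \<open>S[G]\<close>; equivalently there is \<open>t\<close>
  with \<open>tr(t s\<^sup>g)\<close> equal to \<open>1\<close> for \<open>g = 1\<close> and to \<open>0\<close> otherwise. Let \<open>*\<close> be the involution and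
  \<open>\<psi>\<close> the \<open>S\<close>-linear automorphism of \<open>S[G]\<close> given by \<open>g \<mapsto> g\<^sup>2\<close>, which is bijective because \<open>|G|\<close>
  is odd. Conjugation of coefficients by \<open>h\<close> multiplies \<open>r / r*\<close> by \<open>h\<^sup>2\<close>, hence it multiplies
  \<open>q = \<psi>\<^sup>-\<^sup>1(r / r*)\<close> by \<open>h\<close>. So \<open>q\<close> is again a resolvent, and \<open>q q* = 1\<close> says that it
  comes from a self-dual normal basis. Its generator, the coefficient of \<open>q\<close> at \<open>1\<close>, is
  \<open>\<Sum>g. g(s) g\<^sup>-\<^sup>1(t)\<close>.
\<close>

section \<open>Finite sums, and squaring in groups of odd order\<close>

lemma (in abelian_monoid) finsum_swap:
  assumes "finite A" "finite B" "\<And>a b. a \<in> A \<Longrightarrow> b \<in> B \<Longrightarrow> f a b \<in> carrier G"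
  shows "(\<Oplus>a\<in>A. \<Oplus>b\<in>B. f a b) = (\<Oplus>b\<in>B. \<Oplus>a\<in>A. f a b)"
  using assms(1,3)
proof (induction A rule: finite_induct)
  case empty
  then show ?case by simp
next
  case (insert x A)
  have "(\<Oplus>a\<in>insert x A. \<Oplus>b\<in>B. f a b) = (\<Oplus>b\<in>B. f x b) \<oplus> (\<Oplus>a\<in>A. \<Oplus>b\<in>B. f a b)"
    using insert by (intro finsum_insert) (auto intro!: finsum_closed)
  also have "\<dots> = (\<Oplus>b\<in>B. f x b) \<oplus> (\<Oplus>b\<in>B. \<Oplus>a\<in>A. f a b)"
    using insert by simp
  also have "\<dots> = (\<Oplus>b\<in>B. f x b \<oplus> (\<Oplus>a\<in>A. f a b))"
    using insert by (intro finsum_addf[symmetric]) (auto intro!: finsum_closed)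
  also have "\<dots> = (\<Oplus>b\<in>B. \<Oplus>a\<in>insert x A. f a b)"
    using insert by (intro finsum_cong' finsum_insert[symmetric])
      (auto intro!: finsum_closed)
  finally show ?case .
qed

lemma (in abelian_monoid) finsum_bij:
  assumes "bij_betw \<sigma> A B" "f \<in> B \<rightarrow> carrier G"
  shows "(\<Oplus>a\<in>A. f (\<sigma> a)) = (\<Oplus>b\<in>B. f b)"
  using assms finsum_reindex[of f \<sigma> A] by (auto simp: bij_betw_def)

lemma (in semiring) finsum_product:
  assumes "finite A" "finite B" "f \<in> A \<rightarrow> carrier R" "g \<in> B \<rightarrow> carrier R"
  shows "(\<Oplus>a\<in>A. f a) \<otimes> (\<Oplus>b\<in>B. g b) = (\<Oplus>a\<in>A. \<Oplus>b\<in>B. f a \<otimes> g b)"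
proof -
  have "(\<Oplus>a\<in>A. f a) \<otimes> (\<Oplus>b\<in>B. g b) = (\<Oplus>a\<in>A. f a \<otimes> (\<Oplus>b\<in>B. g b))"
    using assms by (intro finsum_ldistr finsum_closed) auto
  also have "\<dots> = (\<Oplus>a\<in>A. \<Oplus>b\<in>B. f a \<otimes> g b)"
    using assms by (intro finsum_cong' finsum_rdistr) (auto intro!: finsum_closed)
  finally show ?thesis .
qed

lemma (in group) bij_betw_mult_left:
  "a \<in> carrier G \<Longrightarrow> bij_betw (\<lambda>x. a \<otimes> x) (carrier G) (carrier G)"
  by (rule bij_betw_byWitness[where f' = "\<lambda>x. inv a \<otimes> x"]) (auto simp: m_assoc[symmetric])

text \<open>If the order is \<open>2 * m + 1\<close>, raising to the power \<open>m + 1\<close>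
  undoes squaring, because \<open>x\<close> to the power \<open>order G + 1\<close> is
  \<open>x\<close>.\<close>

lemma (in group) inj_on_square:
  assumes fin: "finite (carrier G)" and odd: "odd (order G)"
  shows "inj_on (\<lambda>x. x \<otimes> x) (carrier G)"
proof -
  obtain m where m: "order G = 2 * m + 1"
    using odd by (elim oddE)
  have "(x \<otimes> x) [^] (m + 1) = x" if x: "x \<in> carrier G" for x
  proof -
    have "(x \<otimes> x) [^] (m + 1) = (x [^] (2::nat)) [^] (m + 1)"
      using x by (simp add: numeral_2_eq_2)
    also have "\<dots> = x [^] (order G + 1)"
      using x by (simp only: nat_pow_pow m) (simp add: algebra_simps)
    also have "\<dots> = x"
      using x pow_order_eq_1[OF x] by simp
    finally show ?thesis .
  qed
  then show ?thesis
    by (metis (no_types, lifting) inj_onI)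
qed

lemma (in group) bij_betw_square:
  assumes "finite (carrier G)" "odd (order G)"
  shows "bij_betw (\<lambda>x. x \<otimes> x) (carrier G) (carrier G)"
  using endo_inj_surj[OF assms(1) _ inj_on_square[OF assms]] inj_on_square[OF assms]
  by (auto simp: bij_betw_def)

section \<open>Finite abelian groups acting on a commutative ring\<close>

locale cring_action = cring S + \<Gamma>: comm_group \<Gamma>
  for S :: "('a, 'b) ring_scheme" (structure) and \<Gamma> :: "('g, 'c) monoid_scheme" +
  fixes act :: "'g \<Rightarrow> 'a \<Rightarrow> 'a"
  assumes finite_group: "finite (carrier \<Gamma>)"
    and act_hom: "g \<in> carrier \<Gamma> \<Longrightarrow> act g \<in> ring_hom S S"
    and act_mult: "g \<in> carrier \<Gamma> \<Longrightarrow> h \<in> carrier \<Gamma> \<Longrightarrow> x \<in> carrier S \<Longrightarrow>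
      act (g \<otimes>\<^bsub>\<Gamma>\<^esub> h) x = act g (act h x)"
    and act_one: "x \<in> carrier S \<Longrightarrow> act \<one>\<^bsub>\<Gamma>\<^esub> x = x"
begin

lemma act_closed [simp]: "g \<in> carrier \<Gamma> \<Longrightarrow> x \<in> carrier S \<Longrightarrow> act g x \<in> carrier S"
  using act_hom by (auto simp: ring_hom_def)

lemma act_times:
  "g \<in> carrier \<Gamma> \<Longrightarrow> x \<in> carrier S \<Longrightarrow> y \<in> carrier S \<Longrightarrow> act g (x \<otimes> y) = act g x \<otimes> act g y"
  by (rule ring_hom_mult[OF act_hom])

lemma act_zero_one:
  assumes "g \<in> carrier \<Gamma>"
  shows "act g \<one> = \<one>" "act g \<zero> = \<zero>"
  using ring_hom_one[OF act_hom[OF assms]] ring_hom_zero[OF act_hom[OF assms]]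
  by (auto intro: ring_axioms)

lemma act_finsum:
  assumes g: "g \<in> carrier \<Gamma>" and f: "f \<in> A \<rightarrow> carrier S"
  shows "act g (\<Oplus>a\<in>A. f a) = (\<Oplus>a\<in>A. act g (f a))"
proof -
  interpret h: ring_hom_cring S S "act g"
    by unfold_locales (rule act_hom[OF g])
  show ?thesis
    using h.hom_finsum[OF f] by (simp add: comp_def)
qed

section \<open>Dual pairs and inverses of resolvents\<close>

text \<open>The unit of the group ring, as a coefficient function. Taken at h g^-1 it is the
  Kronecker symbol of \<open>h\<close> and \<open>g\<close>, the form in which it occurs
  below.\<close>

definition delta :: "'g \<Rightarrow> 'a"
  where "delta g = (if g = \<one>\<^bsub>\<Gamma>\<^esub> then \<one> else \<zero>)"

lemma delta_closed [simp]: "delta g \<in> carrier S"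
  by (simp add: delta_def)

lemma act_delta: "k \<in> carrier \<Gamma> \<Longrightarrow> act k (delta g) = delta g"
  by (simp add: delta_def act_zero_one)

lemma finsum_delta:
  assumes g: "g \<in> carrier \<Gamma>" and f: "f \<in> carrier \<Gamma> \<rightarrow> carrier S"
  shows "(\<Oplus>h\<in>carrier \<Gamma>. f h \<otimes> delta (h \<otimes>\<^bsub>\<Gamma>\<^esub> inv\<^bsub>\<Gamma>\<^esub> g)) = f g"
proof -
  have "h \<otimes>\<^bsub>\<Gamma>\<^esub> inv\<^bsub>\<Gamma>\<^esub> g = \<one>\<^bsub>\<Gamma>\<^esub> \<longleftrightarrow> g = h" if "h \<in> carrier \<Gamma>" for h
    using that g \<Gamma>.inv_solve_right'[of h "\<one>\<^bsub>\<Gamma>\<^esub>" g]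
    by (metis \<Gamma>.inv_closed \<Gamma>.inv_equality \<Gamma>.inv_inv \<Gamma>.r_inv)
  then have "(\<Oplus>h\<in>carrier \<Gamma>. f h \<otimes> delta (h \<otimes>\<^bsub>\<Gamma>\<^esub> inv\<^bsub>\<Gamma>\<^esub> g)) =
      (\<Oplus>h\<in>carrier \<Gamma>. if g = h then f h else \<zero>)"
    using f by (intro finsum_cong') (auto simp: delta_def Pi_iff)
  also have "\<dots> = f g"
    using finite_group g f by (intro finsum_singleton)
  finally show ?thesis .
qed

text \<open>Each summand is the image under \<open>h\<close> of the product of \<open>t\<close> and
  \<open>act g s\<close>, so the sum is the trace of that product: the conjugates of
  \<open>s\<close> and those of \<open>t\<close> are dual to each other for the trace form. In the
  group ring, the sum of all \<open>act h t\<close> h is inverse to the resolvent of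
  \<open>s\<close>. The case \<open>dual_pair w w\<close> is the self-duality to be reached.\<close>

definition dual_pair :: "'a \<Rightarrow> 'a \<Rightarrow> bool"
  where "dual_pair s t \<longleftrightarrow> s \<in> carrier S \<and> t \<in> carrier S \<and>
    (\<forall>g\<in>carrier \<Gamma>. (\<Oplus>h\<in>carrier \<Gamma>. act h t \<otimes> act (h \<otimes>\<^bsub>\<Gamma>\<^esub> g) s) = delta g)"

text \<open>The trace does not change when its argument is conjugated, so the pair \<open>a\<close>,
  \<open>b\<close> can be moved to the identity and b a^-1. Concretely, \<open>h\<close> is replaced
  by a h in the sum that defines \<open>dual_pair\<close>.\<close>

lemma dual_pair_translate:
  assumes "dual_pair s t" and a: "a \<in> carrier \<Gamma>" and b: "b \<in> carrier \<Gamma>"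
  shows "(\<Oplus>h\<in>carrier \<Gamma>. act (h \<otimes>\<^bsub>\<Gamma>\<^esub> a) t \<otimes> act (h \<otimes>\<^bsub>\<Gamma>\<^esub> b) s) = delta (b \<otimes>\<^bsub>\<Gamma>\<^esub> inv\<^bsub>\<Gamma>\<^esub> a)"
proof -
  have st: "s \<in> carrier S" "t \<in> carrier S"
    using assms(1) by (auto simp: dual_pair_def)
  have eq: "a \<otimes>\<^bsub>\<Gamma>\<^esub> h \<otimes>\<^bsub>\<Gamma>\<^esub> (b \<otimes>\<^bsub>\<Gamma>\<^esub> inv\<^bsub>\<Gamma>\<^esub> a) = h \<otimes>\<^bsub>\<Gamma>\<^esub> b" if h: "h \<in> carrier \<Gamma>" for h
  proof -
    \<comment> \<open>The factor a a^-1 stays uncancelled here, so that both sides are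
      rearrangements of one product; it disappears in the next step.\<close>
    have "a \<otimes>\<^bsub>\<Gamma>\<^esub> h \<otimes>\<^bsub>\<Gamma>\<^esub> (b \<otimes>\<^bsub>\<Gamma>\<^esub> inv\<^bsub>\<Gamma>\<^esub> a) = h \<otimes>\<^bsub>\<Gamma>\<^esub> b \<otimes>\<^bsub>\<Gamma>\<^esub> (a \<otimes>\<^bsub>\<Gamma>\<^esub> inv\<^bsub>\<Gamma>\<^esub> a)"
      using h a b by (simp add: \<Gamma>.m_ac del: \<Gamma>.r_inv \<Gamma>.l_inv \<Gamma>.Units_r_inv \<Gamma>.Units_l_inv)
    then show ?thesis using h a b by simp
  qed
  have "(\<Oplus>h\<in>carrier \<Gamma>. act (h \<otimes>\<^bsub>\<Gamma>\<^esub> a) t \<otimes> act (h \<otimes>\<^bsub>\<Gamma>\<^esub> b) s) =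
      (\<Oplus>h\<in>carrier \<Gamma>. act (a \<otimes>\<^bsub>\<Gamma>\<^esub> h) t \<otimes> act (a \<otimes>\<^bsub>\<Gamma>\<^esub> h \<otimes>\<^bsub>\<Gamma>\<^esub> (b \<otimes>\<^bsub>\<Gamma>\<^esub> inv\<^bsub>\<Gamma>\<^esub> a)) s)"
    using a b st by (intro finsum_cong') (simp_all add: eq \<Gamma>.m_comm[OF _ a])
  also have "\<dots> = (\<Oplus>h\<in>carrier \<Gamma>. act h t \<otimes> act (h \<otimes>\<^bsub>\<Gamma>\<^esub> (b \<otimes>\<^bsub>\<Gamma>\<^esub> inv\<^bsub>\<Gamma>\<^esub> a)) s)"
    using a b st by (intro finsum_bij[OF \<Gamma>.bij_betw_mult_left[OF a]]) (auto intro!: act_closed)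
  also have "\<dots> = delta (b \<otimes>\<^bsub>\<Gamma>\<^esub> inv\<^bsub>\<Gamma>\<^esub> a)"
    using assms by (auto simp: dual_pair_def)
  finally show ?thesis .
qed

text \<open>
  The \<open>d h\<close> are the coefficients of the inverse of the resolvent of \<open>s\<close>. Uniqueness of this
  inverse forces \<open>d h\<close> to be the \<open>h\<close>-conjugate of \<open>d 1\<close>.
\<close>

lemma ex_dual:
  assumes s: "s \<in> carrier S" and d: "d \<in> carrier \<Gamma> \<rightarrow> carrier S"
    and eq: "\<And>g. g \<in> carrier \<Gamma> \<Longrightarrow> (\<Oplus>h\<in>carrier \<Gamma>. d h \<otimes> act (h \<otimes>\<^bsub>\<Gamma>\<^esub> g) s) = delta g"
  shows "dual_pair s (d \<one>\<^bsub>\<Gamma>\<^esub>)"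
proof -
  have conj: "act k (d \<one>\<^bsub>\<Gamma>\<^esub>) = d k" if k: "k \<in> carrier \<Gamma>" for k
  proof -
    \<comment> \<open>Conjugating the coefficients of the resolvent by \<open>k\<close> multiplies
      it by \<open>k\<close>. Hence conjugating its inverse by \<open>k\<close> and multiplying the
      result by \<open>k\<close> gives an inverse again, and \<open>e\<close> lists its
      coefficients. Its value at \<open>k\<close> is the conjugate of \<open>d\<close> at the
      identity.\<close>
    define e where "e h = act k (d (h \<otimes>\<^bsub>\<Gamma>\<^esub> inv\<^bsub>\<Gamma>\<^esub> k))" for h
    have e: "e h \<in> carrier S" if "h \<in> carrier \<Gamma>" for h
      using d k that by (auto simp: e_def intro!: act_closed)
    have dc: "d h \<in> carrier S" if "h \<in> carrier \<Gamma>" for h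
      using d that by auto
    have e_eq: "(\<Oplus>h\<in>carrier \<Gamma>. e h \<otimes> act (h \<otimes>\<^bsub>\<Gamma>\<^esub> g) s) = delta g" if g: "g \<in> carrier \<Gamma>" for g
    proof -
      have "delta g = (\<Oplus>h\<in>carrier \<Gamma>. act k (d h \<otimes> act (h \<otimes>\<^bsub>\<Gamma>\<^esub> g) s))"
        using act_finsum[OF k, of "\<lambda>h. d h \<otimes> act (h \<otimes>\<^bsub>\<Gamma>\<^esub> g) s" "carrier \<Gamma>"] eq[OF g] g k s dc
        by (auto simp: act_delta act_closed)
      also have "\<dots> = (\<Oplus>h\<in>carrier \<Gamma>. e (k \<otimes>\<^bsub>\<Gamma>\<^esub> h) \<otimes> act (k \<otimes>\<^bsub>\<Gamma>\<^esub> h \<otimes>\<^bsub>\<Gamma>\<^esub> g) s)"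
      proof (rule finsum_cong')
        fix h assume h: "h \<in> carrier \<Gamma>"
        have "k \<otimes>\<^bsub>\<Gamma>\<^esub> h \<otimes>\<^bsub>\<Gamma>\<^esub> inv\<^bsub>\<Gamma>\<^esub> k = h"
          using h k by (metis \<Gamma>.inv_solve_right' \<Gamma>.m_closed \<Gamma>.m_comm)
        then show "act k (d h \<otimes> act (h \<otimes>\<^bsub>\<Gamma>\<^esub> g) s) =
            e (k \<otimes>\<^bsub>\<Gamma>\<^esub> h) \<otimes> act (k \<otimes>\<^bsub>\<Gamma>\<^esub> h \<otimes>\<^bsub>\<Gamma>\<^esub> g) s"
          using h k g s dc by (simp add: e_def act_times act_closed \<Gamma>.m_assoc act_mult)
      qed (use e k g s in \<open>auto intro!: act_closed\<close>)
      also have "\<dots> = (\<Oplus>h\<in>carrier \<Gamma>. e h \<otimes> act (h \<otimes>\<^bsub>\<Gamma>\<^esub> g) s)"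
        using g s e
        by (intro finsum_bij[OF \<Gamma>.bij_betw_mult_left[OF k], of "\<lambda>h. e h \<otimes> act (h \<otimes>\<^bsub>\<Gamma>\<^esub> g) s"])
          (auto intro!: act_closed)
      finally show ?thesis by simp
    qed
    \<comment> \<open>Two inverses of one element agree: with \<open>r\<close> the resolvent, e = e
      (d r) = d (e r) = d. The chain is this computation for the coefficient at
      \<open>k\<close>.\<close>
    have "e k = (\<Oplus>h\<in>carrier \<Gamma>. e h \<otimes> delta (h \<otimes>\<^bsub>\<Gamma>\<^esub> inv\<^bsub>\<Gamma>\<^esub> k))"
      using e k by (intro finsum_delta[symmetric]) auto
    also have "\<dots> = (\<Oplus>h\<in>carrier \<Gamma>. \<Oplus>p\<in>carrier \<Gamma>.
        e h \<otimes> (d p \<otimes> act (p \<otimes>\<^bsub>\<Gamma>\<^esub> (h \<otimes>\<^bsub>\<Gamma>\<^esub> inv\<^bsub>\<Gamma>\<^esub> k)) s))"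
      using e k s dc finite_group
      by (intro finsum_cong')
        (auto simp: eq[symmetric] intro!: act_closed finsum_closed finsum_rdistr)
    also have "\<dots> = (\<Oplus>p\<in>carrier \<Gamma>. \<Oplus>h\<in>carrier \<Gamma>.
        e h \<otimes> (d p \<otimes> act (p \<otimes>\<^bsub>\<Gamma>\<^esub> (h \<otimes>\<^bsub>\<Gamma>\<^esub> inv\<^bsub>\<Gamma>\<^esub> k)) s))"
      using e k s dc finite_group by (intro finsum_swap) (auto intro!: act_closed)
    \<comment> \<open>Commutativity turns p (h k^-1) into h (p k^-1), so that the inner sum over
      \<open>h\<close> becomes an instance of \<open>e_eq\<close>.\<close>
    also have "\<dots> = (\<Oplus>p\<in>carrier \<Gamma>. \<Oplus>h\<in>carrier \<Gamma>.
        d p \<otimes> (e h \<otimes> act (h \<otimes>\<^bsub>\<Gamma>\<^esub> (p \<otimes>\<^bsub>\<Gamma>\<^esub> inv\<^bsub>\<Gamma>\<^esub> k)) s))"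
      using e k s dc by (intro finsum_cong') (auto simp: m_ac \<Gamma>.m_ac intro!: act_closed finsum_closed)
    also have "\<dots> = (\<Oplus>p\<in>carrier \<Gamma>. d p \<otimes> delta (p \<otimes>\<^bsub>\<Gamma>\<^esub> inv\<^bsub>\<Gamma>\<^esub> k))"
      using e k s dc finite_group
      by (intro finsum_cong')
        (auto simp: e_eq[symmetric] intro!: act_closed finsum_closed finsum_rdistr[symmetric])
    also have "\<dots> = d k"
      using d k by (intro finsum_delta)
    finally show ?thesis
      using k by (simp add: e_def)
  qed
  have "(\<Oplus>h\<in>carrier \<Gamma>. act h (d \<one>\<^bsub>\<Gamma>\<^esub>) \<otimes> act (h \<otimes>\<^bsub>\<Gamma>\<^esub> g) s) = delta g" if g: "g \<in> carrier \<Gamma>" for g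
    unfolding eq[OF g, symmetric]
    using g s d by (intro finsum_cong') (auto simp: conj intro!: act_closed)
  then show ?thesis
    using s d by (auto simp: dual_pair_def)
qed

text \<open>As \<open>|\<Gamma>|\<close> is odd, \<open>(h, g) \<mapsto> (h g, h g\<^sup>-\<^sup>1)\<close> permutes the pairs of group elements.\<close>

lemma finsum_mult_divide:
  assumes odd: "odd (order \<Gamma>)"
    and F: "F \<in> carrier \<Gamma> \<rightarrow> carrier S" and H: "H \<in> carrier \<Gamma> \<rightarrow> carrier S"
  shows "(\<Oplus>h\<in>carrier \<Gamma>. \<Oplus>g\<in>carrier \<Gamma>. F (h \<otimes>\<^bsub>\<Gamma>\<^esub> g) \<otimes> H (h \<otimes>\<^bsub>\<Gamma>\<^esub> inv\<^bsub>\<Gamma>\<^esub> g)) =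
    (\<Oplus>a\<in>carrier \<Gamma>. F a) \<otimes> (\<Oplus>b\<in>carrier \<Gamma>. H b)"
proof -
  have Fc: "F a \<in> carrier S" and Hc: "H a \<in> carrier S" if "a \<in> carrier \<Gamma>" for a
    using F H that by auto
  \<comment> \<open>For fixed \<open>h\<close> put a = h g; then h g^-1 is a^-1 h^2.\<close>
  have inner: "(\<Oplus>g\<in>carrier \<Gamma>. F (h \<otimes>\<^bsub>\<Gamma>\<^esub> g) \<otimes> H (h \<otimes>\<^bsub>\<Gamma>\<^esub> inv\<^bsub>\<Gamma>\<^esub> g)) =
      (\<Oplus>a\<in>carrier \<Gamma>. F a \<otimes> H (inv\<^bsub>\<Gamma>\<^esub> a \<otimes>\<^bsub>\<Gamma>\<^esub> (h \<otimes>\<^bsub>\<Gamma>\<^esub> h)))" if h: "h \<in> carrier \<Gamma>" for h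
  proof -
    have "inv\<^bsub>\<Gamma>\<^esub> (h \<otimes>\<^bsub>\<Gamma>\<^esub> g) \<otimes>\<^bsub>\<Gamma>\<^esub> (h \<otimes>\<^bsub>\<Gamma>\<^esub> h) = h \<otimes>\<^bsub>\<Gamma>\<^esub> inv\<^bsub>\<Gamma>\<^esub> g" if g: "g \<in> carrier \<Gamma>" for g
    proof -
      have "inv\<^bsub>\<Gamma>\<^esub> (h \<otimes>\<^bsub>\<Gamma>\<^esub> g) \<otimes>\<^bsub>\<Gamma>\<^esub> (h \<otimes>\<^bsub>\<Gamma>\<^esub> h) =
          h \<otimes>\<^bsub>\<Gamma>\<^esub> inv\<^bsub>\<Gamma>\<^esub> g \<otimes>\<^bsub>\<Gamma>\<^esub> (h \<otimes>\<^bsub>\<Gamma>\<^esub> inv\<^bsub>\<Gamma>\<^esub> h)"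
        using g h by (simp add: \<Gamma>.inv_mult \<Gamma>.m_ac del: \<Gamma>.r_inv \<Gamma>.l_inv \<Gamma>.Units_r_inv \<Gamma>.Units_l_inv)
      then show ?thesis using g h by simp
    qed
    then have "(\<Oplus>g\<in>carrier \<Gamma>. F (h \<otimes>\<^bsub>\<Gamma>\<^esub> g) \<otimes> H (h \<otimes>\<^bsub>\<Gamma>\<^esub> inv\<^bsub>\<Gamma>\<^esub> g)) =
      (\<Oplus>g\<in>carrier \<Gamma>. F (h \<otimes>\<^bsub>\<Gamma>\<^esub> g) \<otimes> H (inv\<^bsub>\<Gamma>\<^esub> (h \<otimes>\<^bsub>\<Gamma>\<^esub> g) \<otimes>\<^bsub>\<Gamma>\<^esub> (h \<otimes>\<^bsub>\<Gamma>\<^esub> h)))"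
      using h Fc Hc by (intro finsum_cong') auto
    also have "\<dots> = (\<Oplus>a\<in>carrier \<Gamma>. F a \<otimes> H (inv\<^bsub>\<Gamma>\<^esub> a \<otimes>\<^bsub>\<Gamma>\<^esub> (h \<otimes>\<^bsub>\<Gamma>\<^esub> h)))"
      using h Fc Hc
      by (intro finsum_bij[OF \<Gamma>.bij_betw_mult_left[OF h],
            of "\<lambda>a. F a \<otimes> H (inv\<^bsub>\<Gamma>\<^esub> a \<otimes>\<^bsub>\<Gamma>\<^esub> (h \<otimes>\<^bsub>\<Gamma>\<^esub> h))"]) auto
    finally show ?thesis .
  qed
  have "(\<Oplus>h\<in>carrier \<Gamma>. \<Oplus>g\<in>carrier \<Gamma>. F (h \<otimes>\<^bsub>\<Gamma>\<^esub> g) \<otimes> H (h \<otimes>\<^bsub>\<Gamma>\<^esub> inv\<^bsub>\<Gamma>\<^esub> g)) =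
      (\<Oplus>h\<in>carrier \<Gamma>. \<Oplus>a\<in>carrier \<Gamma>. F a \<otimes> H (inv\<^bsub>\<Gamma>\<^esub> a \<otimes>\<^bsub>\<Gamma>\<^esub> (h \<otimes>\<^bsub>\<Gamma>\<^esub> h)))"
    using Fc Hc by (intro finsum_cong' inner) (auto intro!: finsum_closed)
  also have "\<dots> = (\<Oplus>a\<in>carrier \<Gamma>. \<Oplus>h\<in>carrier \<Gamma>. F a \<otimes> H (inv\<^bsub>\<Gamma>\<^esub> a \<otimes>\<^bsub>\<Gamma>\<^esub> (h \<otimes>\<^bsub>\<Gamma>\<^esub> h)))"
    using finite_group Fc Hc by (intro finsum_swap) auto
  also have "\<dots> = (\<Oplus>a\<in>carrier \<Gamma>. \<Oplus>b\<in>carrier \<Gamma>. F a \<otimes> H b)"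
  proof (rule finsum_cong')
    fix a assume a: "a \<in> carrier \<Gamma>"
    \<comment> \<open>For fixed \<open>a\<close> the second argument a^-1 h^2 runs through the whole
      group once, because squaring is bijective in odd order.\<close>
    have "bij_betw (\<lambda>h. inv\<^bsub>\<Gamma>\<^esub> a \<otimes>\<^bsub>\<Gamma>\<^esub> (h \<otimes>\<^bsub>\<Gamma>\<^esub> h)) (carrier \<Gamma>) (carrier \<Gamma>)"
      using bij_betw_trans[OF \<Gamma>.bij_betw_square[OF finite_group odd]
          \<Gamma>.bij_betw_mult_left[OF \<Gamma>.inv_closed[OF a]]]
      by (simp add: comp_def)
    then show "(\<Oplus>h\<in>carrier \<Gamma>. F a \<otimes> H (inv\<^bsub>\<Gamma>\<^esub> a \<otimes>\<^bsub>\<Gamma>\<^esub> (h \<otimes>\<^bsub>\<Gamma>\<^esub> h))) =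
        (\<Oplus>b\<in>carrier \<Gamma>. F a \<otimes> H b)"
      using a Fc Hc by (intro finsum_bij[of _ _ _ "\<lambda>b. F a \<otimes> H b"]) auto
  qed (use Fc Hc in \<open>auto intro!: finsum_closed\<close>)
  also have "\<dots> = (\<Oplus>a\<in>carrier \<Gamma>. F a) \<otimes> (\<Oplus>b\<in>carrier \<Gamma>. H b)"
    using finite_group F H by (intro finsum_product[symmetric])
  finally show ?thesis .
qed

section \<open>The self-dual generator\<close>

definition self_dual_generator :: "'a \<Rightarrow> 'a \<Rightarrow> 'a"
  where "self_dual_generator s t = (\<Oplus>g\<in>carrier \<Gamma>. act g s \<otimes> act (inv\<^bsub>\<Gamma>\<^esub> g) t)"

text \<open>Expanding the trace of the product of \<open>w\<close> and \<open>act k w\<close> gives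
  a triple sum over \<open>h\<close>, \<open>g\<close>, \<open>f\<close> of products of four
  conjugates. In the variables x = g k f, a = h g, b = h g^-1 each term splits into a factor
  depending on \<open>x\<close> and \<open>a\<close> and one depending on \<open>x\<close> and
  \<open>b\<close>. For fixed \<open>x\<close>, duality of \<open>s\<close> and \<open>t\<close>
  evaluates both sums; together they force x to be the identity and k^2 = x, hence \<open>k\<close>
  is the identity.\<close>

lemma dual_pair_self_dual_generator:
  assumes odd: "odd (order \<Gamma>)" and dual: "dual_pair s t"
  defines "w \<equiv> self_dual_generator s t"
  shows "dual_pair w w"
proof -
  have st: "s \<in> carrier S" "t \<in> carrier S"
    using dual by (auto simp: dual_pair_def)
  have w: "w \<in> carrier S"
    using st by (auto simp: w_def self_dual_generator_def intro!: finsum_closed act_closed)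
  have act_w: "act h w = (\<Oplus>g\<in>carrier \<Gamma>. act (h \<otimes>\<^bsub>\<Gamma>\<^esub> g) s \<otimes> act (h \<otimes>\<^bsub>\<Gamma>\<^esub> inv\<^bsub>\<Gamma>\<^esub> g) t)"
    if h: "h \<in> carrier \<Gamma>" for h
    unfolding w_def self_dual_generator_def
    using act_finsum[OF h, of "\<lambda>g. act g s \<otimes> act (inv\<^bsub>\<Gamma>\<^esub> g) t" "carrier \<Gamma>"] h st
    by (auto simp: act_times act_mult act_closed intro!: finsum_cong')
  have "(\<Oplus>h\<in>carrier \<Gamma>. act h w \<otimes> act (h \<otimes>\<^bsub>\<Gamma>\<^esub> k) w) = delta k" if k: "k \<in> carrier \<Gamma>" for k
  proof -
    \<comment> \<open>Since h k f^-1 = a k^2 x^-1 and h k f = b x, \<open>F\<close> and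
      \<open>H\<close> collect the four conjugates according to \<open>a\<close> and
      \<open>b\<close>. The factors equal to the identity element give both the shape of
      \<open>dual_pair_translate\<close>.\<close>
    define F where "F x a = act (a \<otimes>\<^bsub>\<Gamma>\<^esub> (k \<otimes>\<^bsub>\<Gamma>\<^esub> k \<otimes>\<^bsub>\<Gamma>\<^esub> inv\<^bsub>\<Gamma>\<^esub> x)) t \<otimes> act (a \<otimes>\<^bsub>\<Gamma>\<^esub> \<one>\<^bsub>\<Gamma>\<^esub>) s" for x a
    define H where "H x b = act (b \<otimes>\<^bsub>\<Gamma>\<^esub> \<one>\<^bsub>\<Gamma>\<^esub>) t \<otimes> act (b \<otimes>\<^bsub>\<Gamma>\<^esub> x) s" for x b
    have FH: "F x a \<in> carrier S" "H x a \<in> carrier S" if "x \<in> carrier \<Gamma>" "a \<in> carrier \<Gamma>" for x a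
      using that k st by (auto simp: F_def H_def intro!: act_closed)
    have term_eq: "(act (h \<otimes>\<^bsub>\<Gamma>\<^esub> g) s \<otimes> act (h \<otimes>\<^bsub>\<Gamma>\<^esub> inv\<^bsub>\<Gamma>\<^esub> g) t) \<otimes>
        (act (h \<otimes>\<^bsub>\<Gamma>\<^esub> k \<otimes>\<^bsub>\<Gamma>\<^esub> f) s \<otimes> act (h \<otimes>\<^bsub>\<Gamma>\<^esub> k \<otimes>\<^bsub>\<Gamma>\<^esub> inv\<^bsub>\<Gamma>\<^esub> f) t) =
        F (g \<otimes>\<^bsub>\<Gamma>\<^esub> k \<otimes>\<^bsub>\<Gamma>\<^esub> f) (h \<otimes>\<^bsub>\<Gamma>\<^esub> g) \<otimes> H (g \<otimes>\<^bsub>\<Gamma>\<^esub> k \<otimes>\<^bsub>\<Gamma>\<^esub> f) (h \<otimes>\<^bsub>\<Gamma>\<^esub> inv\<^bsub>\<Gamma>\<^esub> g)"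
      if "h \<in> carrier \<Gamma>" "g \<in> carrier \<Gamma>" "f \<in> carrier \<Gamma>" for h g f
    proof -
      have "h \<otimes>\<^bsub>\<Gamma>\<^esub> g \<otimes>\<^bsub>\<Gamma>\<^esub> (k \<otimes>\<^bsub>\<Gamma>\<^esub> k \<otimes>\<^bsub>\<Gamma>\<^esub> inv\<^bsub>\<Gamma>\<^esub> (g \<otimes>\<^bsub>\<Gamma>\<^esub> k \<otimes>\<^bsub>\<Gamma>\<^esub> f)) =
          h \<otimes>\<^bsub>\<Gamma>\<^esub> k \<otimes>\<^bsub>\<Gamma>\<^esub> inv\<^bsub>\<Gamma>\<^esub> f \<otimes>\<^bsub>\<Gamma>\<^esub> (g \<otimes>\<^bsub>\<Gamma>\<^esub> inv\<^bsub>\<Gamma>\<^esub> g) \<otimes>\<^bsub>\<Gamma>\<^esub> (k \<otimes>\<^bsub>\<Gamma>\<^esub> inv\<^bsub>\<Gamma>\<^esub> k)"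
        using that k by (simp add: \<Gamma>.inv_mult \<Gamma>.m_ac del: \<Gamma>.r_inv \<Gamma>.l_inv \<Gamma>.Units_r_inv \<Gamma>.Units_l_inv)
      moreover have "h \<otimes>\<^bsub>\<Gamma>\<^esub> inv\<^bsub>\<Gamma>\<^esub> g \<otimes>\<^bsub>\<Gamma>\<^esub> (g \<otimes>\<^bsub>\<Gamma>\<^esub> k \<otimes>\<^bsub>\<Gamma>\<^esub> f) =
          h \<otimes>\<^bsub>\<Gamma>\<^esub> k \<otimes>\<^bsub>\<Gamma>\<^esub> f \<otimes>\<^bsub>\<Gamma>\<^esub> (g \<otimes>\<^bsub>\<Gamma>\<^esub> inv\<^bsub>\<Gamma>\<^esub> g)"
        using that k by (simp add: \<Gamma>.m_ac del: \<Gamma>.r_inv \<Gamma>.l_inv \<Gamma>.Units_r_inv \<Gamma>.Units_l_inv)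
      ultimately show ?thesis
        using that k st by (simp add: F_def H_def act_closed m_ac)
    qed
    have "(\<Oplus>h\<in>carrier \<Gamma>. act h w \<otimes> act (h \<otimes>\<^bsub>\<Gamma>\<^esub> k) w) =
        (\<Oplus>h\<in>carrier \<Gamma>. \<Oplus>g\<in>carrier \<Gamma>. \<Oplus>x\<in>carrier \<Gamma>.
          F x (h \<otimes>\<^bsub>\<Gamma>\<^esub> g) \<otimes> H x (h \<otimes>\<^bsub>\<Gamma>\<^esub> inv\<^bsub>\<Gamma>\<^esub> g))"
    proof (rule finsum_cong')
      fix h assume h: "h \<in> carrier \<Gamma>"
      have "act h w \<otimes> act (h \<otimes>\<^bsub>\<Gamma>\<^esub> k) w =
          (\<Oplus>g\<in>carrier \<Gamma>. \<Oplus>f\<in>carrier \<Gamma>. (act (h \<otimes>\<^bsub>\<Gamma>\<^esub> g) s \<otimes> act (h \<otimes>\<^bsub>\<Gamma>\<^esub> inv\<^bsub>\<Gamma>\<^esub> g) t) \<otimes>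
            (act (h \<otimes>\<^bsub>\<Gamma>\<^esub> k \<otimes>\<^bsub>\<Gamma>\<^esub> f) s \<otimes> act (h \<otimes>\<^bsub>\<Gamma>\<^esub> k \<otimes>\<^bsub>\<Gamma>\<^esub> inv\<^bsub>\<Gamma>\<^esub> f) t))"
        unfolding act_w[OF h] act_w[OF \<Gamma>.m_closed[OF h k]]
        using h k st finite_group by (intro finsum_product) (auto intro!: act_closed)
      also have "\<dots> = (\<Oplus>g\<in>carrier \<Gamma>. \<Oplus>x\<in>carrier \<Gamma>.
          F x (h \<otimes>\<^bsub>\<Gamma>\<^esub> g) \<otimes> H x (h \<otimes>\<^bsub>\<Gamma>\<^esub> inv\<^bsub>\<Gamma>\<^esub> g))"
      proof (rule finsum_cong')
        fix g assume g: "g \<in> carrier \<Gamma>"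
        have "(\<Oplus>f\<in>carrier \<Gamma>. (act (h \<otimes>\<^bsub>\<Gamma>\<^esub> g) s \<otimes> act (h \<otimes>\<^bsub>\<Gamma>\<^esub> inv\<^bsub>\<Gamma>\<^esub> g) t) \<otimes>
            (act (h \<otimes>\<^bsub>\<Gamma>\<^esub> k \<otimes>\<^bsub>\<Gamma>\<^esub> f) s \<otimes> act (h \<otimes>\<^bsub>\<Gamma>\<^esub> k \<otimes>\<^bsub>\<Gamma>\<^esub> inv\<^bsub>\<Gamma>\<^esub> f) t)) =
            (\<Oplus>f\<in>carrier \<Gamma>. F (g \<otimes>\<^bsub>\<Gamma>\<^esub> k \<otimes>\<^bsub>\<Gamma>\<^esub> f) (h \<otimes>\<^bsub>\<Gamma>\<^esub> g) \<otimes>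
              H (g \<otimes>\<^bsub>\<Gamma>\<^esub> k \<otimes>\<^bsub>\<Gamma>\<^esub> f) (h \<otimes>\<^bsub>\<Gamma>\<^esub> inv\<^bsub>\<Gamma>\<^esub> g))"
          using g h k by (intro finsum_cong' term_eq) (auto intro!: FH)
        \<comment> \<open>For fixed \<open>g\<close>, the map taking \<open>f\<close> to x = g k f
          is a translation.\<close>
        also have "\<dots> = (\<Oplus>x\<in>carrier \<Gamma>. F x (h \<otimes>\<^bsub>\<Gamma>\<^esub> g) \<otimes> H x (h \<otimes>\<^bsub>\<Gamma>\<^esub> inv\<^bsub>\<Gamma>\<^esub> g))"
          using g h k by (intro finsum_bij[OF \<Gamma>.bij_betw_mult_left,
                of _ "\<lambda>x. F x (h \<otimes>\<^bsub>\<Gamma>\<^esub> g) \<otimes> H x (h \<otimes>\<^bsub>\<Gamma>\<^esub> inv\<^bsub>\<Gamma>\<^esub> g)"]) (auto intro!: FH)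
        finally show "(\<Oplus>f\<in>carrier \<Gamma>. (act (h \<otimes>\<^bsub>\<Gamma>\<^esub> g) s \<otimes> act (h \<otimes>\<^bsub>\<Gamma>\<^esub> inv\<^bsub>\<Gamma>\<^esub> g) t) \<otimes>
            (act (h \<otimes>\<^bsub>\<Gamma>\<^esub> k \<otimes>\<^bsub>\<Gamma>\<^esub> f) s \<otimes> act (h \<otimes>\<^bsub>\<Gamma>\<^esub> k \<otimes>\<^bsub>\<Gamma>\<^esub> inv\<^bsub>\<Gamma>\<^esub> f) t)) =
            (\<Oplus>x\<in>carrier \<Gamma>. F x (h \<otimes>\<^bsub>\<Gamma>\<^esub> g) \<otimes> H x (h \<otimes>\<^bsub>\<Gamma>\<^esub> inv\<^bsub>\<Gamma>\<^esub> g))" .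
      qed (use h FH in \<open>auto intro!: finsum_closed\<close>)
      finally show "act h w \<otimes> act (h \<otimes>\<^bsub>\<Gamma>\<^esub> k) w = (\<Oplus>g\<in>carrier \<Gamma>. \<Oplus>x\<in>carrier \<Gamma>.
          F x (h \<otimes>\<^bsub>\<Gamma>\<^esub> g) \<otimes> H x (h \<otimes>\<^bsub>\<Gamma>\<^esub> inv\<^bsub>\<Gamma>\<^esub> g))" .
    qed (use FH in \<open>auto intro!: finsum_closed\<close>)
    also have "\<dots> = (\<Oplus>h\<in>carrier \<Gamma>. \<Oplus>x\<in>carrier \<Gamma>. \<Oplus>g\<in>carrier \<Gamma>.
          F x (h \<otimes>\<^bsub>\<Gamma>\<^esub> g) \<otimes> H x (h \<otimes>\<^bsub>\<Gamma>\<^esub> inv\<^bsub>\<Gamma>\<^esub> g))"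
      using FH finite_group by (intro finsum_cong' finsum_swap) (auto intro!: finsum_closed)
    also have "\<dots> = (\<Oplus>x\<in>carrier \<Gamma>. \<Oplus>h\<in>carrier \<Gamma>. \<Oplus>g\<in>carrier \<Gamma>.
          F x (h \<otimes>\<^bsub>\<Gamma>\<^esub> g) \<otimes> H x (h \<otimes>\<^bsub>\<Gamma>\<^esub> inv\<^bsub>\<Gamma>\<^esub> g))"
      using FH finite_group by (intro finsum_swap) (auto intro!: finsum_closed)
    also have "\<dots> = (\<Oplus>x\<in>carrier \<Gamma>. delta (k \<otimes>\<^bsub>\<Gamma>\<^esub> k \<otimes>\<^bsub>\<Gamma>\<^esub> inv\<^bsub>\<Gamma>\<^esub> x) \<otimes> delta (x \<otimes>\<^bsub>\<Gamma>\<^esub> inv\<^bsub>\<Gamma>\<^esub> \<one>\<^bsub>\<Gamma>\<^esub>))"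
    proof (rule finsum_cong')
      fix x assume x: "x \<in> carrier \<Gamma>"
      have inv_delta: "delta (\<one>\<^bsub>\<Gamma>\<^esub> \<otimes>\<^bsub>\<Gamma>\<^esub> inv\<^bsub>\<Gamma>\<^esub> y) = delta y" if "y \<in> carrier \<Gamma>" for y
        using that by (simp add: delta_def)
      have "(\<Oplus>h\<in>carrier \<Gamma>. \<Oplus>g\<in>carrier \<Gamma>. F x (h \<otimes>\<^bsub>\<Gamma>\<^esub> g) \<otimes> H x (h \<otimes>\<^bsub>\<Gamma>\<^esub> inv\<^bsub>\<Gamma>\<^esub> g)) =
          (\<Oplus>a\<in>carrier \<Gamma>. F x a) \<otimes> (\<Oplus>b\<in>carrier \<Gamma>. H x b)"
        using x FH by (intro finsum_mult_divide odd) auto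
      also have "(\<Oplus>a\<in>carrier \<Gamma>. F x a) = delta (k \<otimes>\<^bsub>\<Gamma>\<^esub> k \<otimes>\<^bsub>\<Gamma>\<^esub> inv\<^bsub>\<Gamma>\<^esub> x)"
        using x k inv_delta unfolding F_def by (simp add: dual_pair_translate[OF dual])
      also have "(\<Oplus>b\<in>carrier \<Gamma>. H x b) = delta (x \<otimes>\<^bsub>\<Gamma>\<^esub> inv\<^bsub>\<Gamma>\<^esub> \<one>\<^bsub>\<Gamma>\<^esub>)"
        using x unfolding H_def by (intro dual_pair_translate[OF dual]) auto
      finally show "(\<Oplus>h\<in>carrier \<Gamma>. \<Oplus>g\<in>carrier \<Gamma>. F x (h \<otimes>\<^bsub>\<Gamma>\<^esub> g) \<otimes> H x (h \<otimes>\<^bsub>\<Gamma>\<^esub> inv\<^bsub>\<Gamma>\<^esub> g)) =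
          delta (k \<otimes>\<^bsub>\<Gamma>\<^esub> k \<otimes>\<^bsub>\<Gamma>\<^esub> inv\<^bsub>\<Gamma>\<^esub> x) \<otimes> delta (x \<otimes>\<^bsub>\<Gamma>\<^esub> inv\<^bsub>\<Gamma>\<^esub> \<one>\<^bsub>\<Gamma>\<^esub>)" .
    qed auto
    also have "\<dots> = delta (k \<otimes>\<^bsub>\<Gamma>\<^esub> k)"
      using finsum_delta[of "\<one>\<^bsub>\<Gamma>\<^esub>" "\<lambda>x. delta (k \<otimes>\<^bsub>\<Gamma>\<^esub> k \<otimes>\<^bsub>\<Gamma>\<^esub> inv\<^bsub>\<Gamma>\<^esub> x)"] k by simp
    \<comment> \<open>In odd order, k^2 is the identity only if \<open>k\<close> is.\<close>
    also have "\<dots> = delta k"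
      using inj_onD[OF \<Gamma>.inj_on_square[OF finite_group odd], of k "\<one>\<^bsub>\<Gamma>\<^esub>"] k
      by (auto simp: delta_def)
    finally show ?thesis .
  qed
  then show ?thesis
    using w by (simp add: dual_pair_def)
qed

section \<open>Expansions in conjugates and their coefficients\<close>

text \<open>The coefficients are the traces against the conjugates of \<open>w\<close>. After
  exchanging the sums, the factor at \<open>act h x\<close> is the sum in
  \<open>dual_pair w w\<close> at \<open>h\<close>, so only the identity contributes. This makes the
  conjugates of \<open>w\<close> span.\<close>

lemma dual_pair_expand:
  assumes dual: "dual_pair w w" and x: "x \<in> carrier S"
  shows "x = (\<Oplus>g\<in>carrier \<Gamma>. (\<Oplus>h\<in>carrier \<Gamma>. act h (x \<otimes> act g w)) \<otimes> act g w)"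
proof -
  have w: "w \<in> carrier S"
    using dual by (auto simp: dual_pair_def)
  have "(\<Oplus>g\<in>carrier \<Gamma>. (\<Oplus>h\<in>carrier \<Gamma>. act h (x \<otimes> act g w)) \<otimes> act g w) =
      (\<Oplus>g\<in>carrier \<Gamma>. \<Oplus>h\<in>carrier \<Gamma>. act h x \<otimes> (act g w \<otimes> act (g \<otimes>\<^bsub>\<Gamma>\<^esub> h) w))"
  proof (rule finsum_cong')
    fix g assume g: "g \<in> carrier \<Gamma>"
    have "(\<Oplus>h\<in>carrier \<Gamma>. act h (x \<otimes> act g w)) \<otimes> act g w =
        (\<Oplus>h\<in>carrier \<Gamma>. act h (x \<otimes> act g w) \<otimes> act g w)"
      using g w x finite_group by (intro finsum_ldistr) (auto intro!: act_closed)
    also have "\<dots> = (\<Oplus>h\<in>carrier \<Gamma>. act h x \<otimes> (act g w \<otimes> act (g \<otimes>\<^bsub>\<Gamma>\<^esub> h) w))"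
    proof (rule finsum_cong')
      fix h assume h: "h \<in> carrier \<Gamma>"
      have "act h (act g w) = act (g \<otimes>\<^bsub>\<Gamma>\<^esub> h) w"
        using g h w by (simp add: act_mult[symmetric] \<Gamma>.m_comm)
      then show "act h (x \<otimes> act g w) \<otimes> act g w = act h x \<otimes> (act g w \<otimes> act (g \<otimes>\<^bsub>\<Gamma>\<^esub> h) w)"
        using g h w x by (simp add: act_times act_closed m_ac)
    qed (use g w x in \<open>auto intro!: act_closed\<close>)
    finally show "(\<Oplus>h\<in>carrier \<Gamma>. act h (x \<otimes> act g w)) \<otimes> act g w =
        (\<Oplus>h\<in>carrier \<Gamma>. act h x \<otimes> (act g w \<otimes> act (g \<otimes>\<^bsub>\<Gamma>\<^esub> h) w))" .
  qed (use w x in \<open>auto intro!: act_closed finsum_closed\<close>)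
  also have "\<dots> = (\<Oplus>h\<in>carrier \<Gamma>. \<Oplus>g\<in>carrier \<Gamma>. act h x \<otimes> (act g w \<otimes> act (g \<otimes>\<^bsub>\<Gamma>\<^esub> h) w))"
    using w x finite_group by (intro finsum_swap) (auto intro!: act_closed)
  also have "\<dots> = (\<Oplus>h\<in>carrier \<Gamma>. act h x \<otimes> delta (h \<otimes>\<^bsub>\<Gamma>\<^esub> inv\<^bsub>\<Gamma>\<^esub> \<one>\<^bsub>\<Gamma>\<^esub>))"
  proof (rule finsum_cong')
    fix h assume h: "h \<in> carrier \<Gamma>"
    have "(\<Oplus>g\<in>carrier \<Gamma>. act g w \<otimes> act (g \<otimes>\<^bsub>\<Gamma>\<^esub> h) w) = delta h"
      using dual h by (simp add: dual_pair_def)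
    then show "(\<Oplus>g\<in>carrier \<Gamma>. act h x \<otimes> (act g w \<otimes> act (g \<otimes>\<^bsub>\<Gamma>\<^esub> h) w)) =
        act h x \<otimes> delta (h \<otimes>\<^bsub>\<Gamma>\<^esub> inv\<^bsub>\<Gamma>\<^esub> \<one>\<^bsub>\<Gamma>\<^esub>)"
      using h w x finite_group
        finsum_rdistr[of "carrier \<Gamma>" "act h x" "\<lambda>g. act g w \<otimes> act (g \<otimes>\<^bsub>\<Gamma>\<^esub> h) w"]
      by (simp add: act_closed Pi_iff)
  qed (use x in \<open>auto intro!: act_closed\<close>)
  also have "\<dots> = x"
    using finsum_delta[of "\<one>\<^bsub>\<Gamma>\<^esub>" "\<lambda>h. act h x"] x by (simp add: act_closed act_one)
  finally show ?thesis by simp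
qed

text \<open>The sum over \<open>h\<close> stands for an element of the ring written in a normal
  basis with invariant coefficients \<open>c p h\<close>. As \<open>act g\<close> fixes these,
  collecting the terms at each conjugate of \<open>s\<close> gives coefficients \<open>d\<close> to
  which \<open>ex_dual\<close> applies.\<close>

lemma ex_dual_if_generated:
  assumes s: "s \<in> carrier S" and I: "finite I" and a: "a \<in> I \<rightarrow> carrier S"
    and c: "\<And>p. p \<in> I \<Longrightarrow> c p \<in> carrier \<Gamma> \<rightarrow> carrier S"
    and fixed: "\<And>p g h. p \<in> I \<Longrightarrow> g \<in> carrier \<Gamma> \<Longrightarrow> h \<in> carrier \<Gamma> \<Longrightarrow> act g (c p h) = c p h"
    and eq: "\<And>g. g \<in> carrier \<Gamma> \<Longrightarrow>
      (\<Oplus>p\<in>I. a p \<otimes> act g (\<Oplus>h\<in>carrier \<Gamma>. c p h \<otimes> act h s)) = delta g"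
  shows "\<exists>t. dual_pair s t"
proof -
  define d where "d h = (\<Oplus>p\<in>I. a p \<otimes> c p h)" for h
  have ac: "a p \<in> carrier S" "h \<in> carrier \<Gamma> \<Longrightarrow> c p h \<in> carrier S" if "p \<in> I" for p h
    using that a c by (auto simp: Pi_iff)
  have "(\<Oplus>h\<in>carrier \<Gamma>. d h \<otimes> act (h \<otimes>\<^bsub>\<Gamma>\<^esub> g) s) = delta g" if g: "g \<in> carrier \<Gamma>" for g
  proof -
    have "(\<Oplus>h\<in>carrier \<Gamma>. d h \<otimes> act (h \<otimes>\<^bsub>\<Gamma>\<^esub> g) s) =
        (\<Oplus>h\<in>carrier \<Gamma>. \<Oplus>p\<in>I. a p \<otimes> c p h \<otimes> act (h \<otimes>\<^bsub>\<Gamma>\<^esub> g) s)"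
      unfolding d_def using g s I ac
      by (intro finsum_cong'[OF refl] finsum_ldistr) (auto intro!: finsum_closed)
    also have "\<dots> = (\<Oplus>p\<in>I. \<Oplus>h\<in>carrier \<Gamma>. a p \<otimes> c p h \<otimes> act (h \<otimes>\<^bsub>\<Gamma>\<^esub> g) s)"
      using g s I ac finite_group by (intro finsum_swap) auto
    also have "\<dots> = (\<Oplus>p\<in>I. a p \<otimes> act g (\<Oplus>h\<in>carrier \<Gamma>. c p h \<otimes> act h s))"
    proof (rule finsum_cong')
      fix p assume p: "p \<in> I"
      have "act g (\<Oplus>h\<in>carrier \<Gamma>. c p h \<otimes> act h s) = (\<Oplus>h\<in>carrier \<Gamma>. act g (c p h \<otimes> act h s))"
        using g s ac[OF p] by (intro act_finsum) auto
      also have "\<dots> = (\<Oplus>h\<in>carrier \<Gamma>. c p h \<otimes> act (h \<otimes>\<^bsub>\<Gamma>\<^esub> g) s)"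
        using g s ac[OF p] fixed[OF p]
        by (intro finsum_cong') (auto simp: act_times act_mult \<Gamma>.m_comm[of _ g])
      finally have "a p \<otimes> act g (\<Oplus>h\<in>carrier \<Gamma>. c p h \<otimes> act h s) =
          (\<Oplus>h\<in>carrier \<Gamma>. a p \<otimes> (c p h \<otimes> act (h \<otimes>\<^bsub>\<Gamma>\<^esub> g) s))"
        using g s ac[OF p] finite_group by (auto intro!: finsum_rdistr)
      then show "(\<Oplus>h\<in>carrier \<Gamma>. a p \<otimes> c p h \<otimes> act (h \<otimes>\<^bsub>\<Gamma>\<^esub> g) s) =
          a p \<otimes> act g (\<Oplus>h\<in>carrier \<Gamma>. c p h \<otimes> act h s)"
        using g s ac[OF p] by (auto simp: m_assoc intro!: finsum_cong')
    qed (use g s ac in \<open>auto intro!: finsum_closed\<close>)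
    finally show ?thesis
      using eq[OF g] by simp
  qed
  moreover have "d \<in> carrier \<Gamma> \<rightarrow> carrier S"
    using ac by (auto simp: d_def intro!: finsum_closed)
  ultimately show ?thesis
    using ex_dual[OF s] by blast
qed

text \<open>The trace is linear over invariant elements, and duality kills every term but the one at
  \<open>g\<close>. A relation between the conjugates of \<open>w\<close> thus has only zero
  coefficients.\<close>

lemma trace_coefficient:
  assumes dual: "dual_pair w w" and g: "g \<in> carrier \<Gamma>"
    and c: "c \<in> carrier \<Gamma> \<rightarrow> carrier S"
    and fixed: "\<And>g h. g \<in> carrier \<Gamma> \<Longrightarrow> h \<in> carrier \<Gamma> \<Longrightarrow> act g (c h) = c h"
  shows "(\<Oplus>k\<in>carrier \<Gamma>. act k ((\<Oplus>h\<in>carrier \<Gamma>. c h \<otimes> act h w) \<otimes> act g w)) = c g"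
proof -
  have w: "w \<in> carrier S"
    using dual by (auto simp: dual_pair_def)
  have cc: "c h \<in> carrier S" if "h \<in> carrier \<Gamma>" for h
    using that c by auto
  have "(\<Oplus>k\<in>carrier \<Gamma>. act k ((\<Oplus>h\<in>carrier \<Gamma>. c h \<otimes> act h w) \<otimes> act g w)) =
      (\<Oplus>k\<in>carrier \<Gamma>. \<Oplus>h\<in>carrier \<Gamma>. c h \<otimes> (act (k \<otimes>\<^bsub>\<Gamma>\<^esub> g) w \<otimes> act (k \<otimes>\<^bsub>\<Gamma>\<^esub> h) w))"
  proof (rule finsum_cong')
    fix k assume k: "k \<in> carrier \<Gamma>"
    have "act k ((\<Oplus>h\<in>carrier \<Gamma>. c h \<otimes> act h w) \<otimes> act g w) =
        (\<Oplus>h\<in>carrier \<Gamma>. act k (c h \<otimes> act h w)) \<otimes> act (k \<otimes>\<^bsub>\<Gamma>\<^esub> g) w"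
      using k g w cc act_finsum[OF k, of "\<lambda>h. c h \<otimes> act h w" "carrier \<Gamma>"]
      by (auto simp: act_times act_mult)
    also have "\<dots> = (\<Oplus>h\<in>carrier \<Gamma>. act k (c h \<otimes> act h w) \<otimes> act (k \<otimes>\<^bsub>\<Gamma>\<^esub> g) w)"
      using k g w cc finite_group by (intro finsum_ldistr) auto
    also have "\<dots> = (\<Oplus>h\<in>carrier \<Gamma>. c h \<otimes> (act (k \<otimes>\<^bsub>\<Gamma>\<^esub> g) w \<otimes> act (k \<otimes>\<^bsub>\<Gamma>\<^esub> h) w))"
      using k g w cc fixed by (intro finsum_cong') (auto simp: act_times act_mult m_ac)
    finally show "act k ((\<Oplus>h\<in>carrier \<Gamma>. c h \<otimes> act h w) \<otimes> act g w) =
        (\<Oplus>h\<in>carrier \<Gamma>. c h \<otimes> (act (k \<otimes>\<^bsub>\<Gamma>\<^esub> g) w \<otimes> act (k \<otimes>\<^bsub>\<Gamma>\<^esub> h) w))" .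
  qed (use g w cc in \<open>auto intro!: finsum_closed\<close>)
  also have "\<dots> = (\<Oplus>h\<in>carrier \<Gamma>. \<Oplus>k\<in>carrier \<Gamma>. c h \<otimes> (act (k \<otimes>\<^bsub>\<Gamma>\<^esub> g) w \<otimes> act (k \<otimes>\<^bsub>\<Gamma>\<^esub> h) w))"
    using g w cc finite_group by (intro finsum_swap) auto
  also have "\<dots> = (\<Oplus>h\<in>carrier \<Gamma>. c h \<otimes> delta (h \<otimes>\<^bsub>\<Gamma>\<^esub> inv\<^bsub>\<Gamma>\<^esub> g))"
  proof (rule finsum_cong')
    fix h assume h: "h \<in> carrier \<Gamma>"
    show "(\<Oplus>k\<in>carrier \<Gamma>. c h \<otimes> (act (k \<otimes>\<^bsub>\<Gamma>\<^esub> g) w \<otimes> act (k \<otimes>\<^bsub>\<Gamma>\<^esub> h) w)) =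
        c h \<otimes> delta (h \<otimes>\<^bsub>\<Gamma>\<^esub> inv\<^bsub>\<Gamma>\<^esub> g)"
      unfolding dual_pair_translate[OF dual g h, symmetric]
      using g h w cc finite_group by (intro finsum_rdistr[symmetric]) auto
  qed (use cc in auto)
  also have "\<dots> = c g"
    using g c by (rule finsum_delta)
  finally show ?thesis .
qed

end

section \<open>Application to Galois extensions\<close>

text \<open>A preimage of \<open>f\<close> under the Galois map is a coset of some \<open>c\<close>
  in the free abelian group. The keys of \<open>c\<close> serve as index set, and the integer
  multiplicities are absorbed into the first tensor factors.\<close>

lemma ex_galois_coordinates:
  fixes S :: "('a, 'b) ring_scheme"
  assumes gal: "galois_extension S R G" and f: "f \<in> G \<rightarrow>\<^sub>E carrier S"
  obtains I :: "('a \<times> 'a) set" and a b where "finite I" "a \<in> I \<rightarrow> carrier S" "b \<in> I \<rightarrow> carrier S"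
    "\<And>g. g \<in> G \<Longrightarrow> (\<Oplus>\<^bsub>S\<^esub>p\<in>I. a p \<otimes>\<^bsub>S\<^esub> g (b p)) = f g"
proof -
  interpret S: cring S
    using gal by (simp add: galois_extension_def)
  have G: "G \<subseteq> ring_auto S" and R: "R = fixed_ring S G"
    using gal subgroup_ring_aut_group_subset by (auto simp: galois_extension_def)
  obtain T where T: "T \<in> carrier (tensor_square S R)" "f = galois_map S G T"
    using gal f unfolding galois_extension_def by (metis (no_types, lifting) imageE)
  obtain c where c: "c \<in> carrier (free_Abelian_group (carrier S \<times> carrier S))"
    "T = tensor_kernel S R #>\<^bsub>free_Abelian_group (carrier S \<times> carrier S)\<^esub> c"
    using T(1) by (auto simp: tensor_square_def FactGroup_def RCOSETS_def)
  have f_eq: "f = galois_map_free S G c"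
    using galois_map_coset[OF S.cring_axioms G c(1)] T(2) c(2) R by simp
  have keys: "fst p \<in> carrier S" "snd p \<in> carrier S" if "p \<in> Poly_Mapping.keys c" for p
    using c(1) that by auto
  show ?thesis
  proof (rule that[of "Poly_Mapping.keys c" "\<lambda>p. [Poly_Mapping.lookup c p] \<cdot>\<^bsub>S\<^esub> fst p" snd])
    show "finite (Poly_Mapping.keys c)" by simp
    show "(\<lambda>p. [Poly_Mapping.lookup c p] \<cdot>\<^bsub>S\<^esub> fst p) \<in> Poly_Mapping.keys c \<rightarrow> carrier S"
      using keys by auto
    show "snd \<in> Poly_Mapping.keys c \<rightarrow> carrier S"
      using keys by auto
    fix g assume g: "g \<in> G"
    show "(\<Oplus>\<^bsub>S\<^esub>p\<in>Poly_Mapping.keys c.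
        ([Poly_Mapping.lookup c p] \<cdot>\<^bsub>S\<^esub> fst p) \<otimes>\<^bsub>S\<^esub> g (snd p)) = f g"
      unfolding f_eq galois_map_free_def restrict_apply if_P[OF g]
    proof (intro S.finsum_cong')
      fix p assume "p \<in> Poly_Mapping.keys c"
      then have "fst p \<in> carrier S" "g (snd p) \<in> carrier S"
        using keys ring_auto_closed[OF subsetD[OF G g]] by auto
      then show "([Poly_Mapping.lookup c p] \<cdot>\<^bsub>S\<^esub> fst p) \<otimes>\<^bsub>S\<^esub> g (snd p) =
          [Poly_Mapping.lookup c p] \<cdot>\<^bsub>S\<^esub> (fst p \<otimes>\<^bsub>S\<^esub> g (snd p))"
        by (rule S.add_pow_ldistr_int)
    qed (use keys ring_auto_closed[OF subsetD[OF G g]] in auto)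
  qed
qed

text \<open>The automorphisms act by evaluation. Their product is composition restricted to
  \<open>carrier S\<close>, so it agrees with the iterated action at elements of
  \<open>S\<close>.\<close>

lemma cring_action_galois_group:
  assumes gal: "galois_extension S R G" and comm: "comm_group (ring_aut_group S \<lparr>carrier := G\<rparr>)"
  shows "cring_action S (ring_aut_group S \<lparr>carrier := G\<rparr>) (\<lambda>g. g)"
proof -
  have G: "G \<subseteq> ring_auto S"
    using gal subgroup_ring_aut_group_subset by (auto simp: galois_extension_def)
  show ?thesis
  proof (intro cring_action.intro cring_action_axioms.intro comm)
    show "cring S" "finite (carrier (ring_aut_group S \<lparr>carrier := G\<rparr>))"
      using gal by (auto simp: galois_extension_def)
  next
    fix g h x
    assume "g \<in> carrier (ring_aut_group S \<lparr>carrier := G\<rparr>)"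
      "h \<in> carrier (ring_aut_group S \<lparr>carrier := G\<rparr>)" "x \<in> carrier S"
    then show "(g \<otimes>\<^bsub>ring_aut_group S \<lparr>carrier := G\<rparr>\<^esub> h) x = g (h x)"
      using G by (auto simp: ring_aut_group_def BijGroup_def ring_auto_def subset_iff compose_def)
  qed (use G in \<open>auto simp: ring_aut_group_def BijGroup_def ring_auto_def\<close>)
qed

theorem theorem2:
  fixes S :: "('a, 'b) ring_scheme" and R :: "'a set" and G :: "('a \<Rightarrow> 'a) set"
  assumes "galois_extension S R G"
    and "comm_group (ring_aut_group S \<lparr>carrier := G\<rparr>)"
    and "odd (card G)"
    and "\<exists>s. generates_normal_basis S R G s"
  shows "\<exists>s. generates_self_dual_normal_basis S R G s"
proof -
  define \<Gamma> where "\<Gamma> = ring_aut_group S \<lparr>carrier := G\<rparr>"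
  interpret cring_action S \<Gamma> "\<lambda>g. g"
    unfolding \<Gamma>_def by (rule cring_action_galois_group[OF assms(1,2)])
  have carrier: "carrier \<Gamma> = G"
    by (simp add: \<Gamma>_def)
  have R: "R = fixed_ring S G"
    using assms(1) by (simp add: galois_extension_def)
  have RS: "r \<in> carrier S" and Rfix: "g \<in> G \<Longrightarrow> g r = r" if "r \<in> R" for r g
    using that by (auto simp: R fixed_ring_def)
  obtain s where s: "s \<in> carrier S"
    and span: "\<And>x. x \<in> carrier S \<Longrightarrow> \<exists>c\<in>G \<rightarrow> R. x = (\<Oplus>\<^bsub>S\<^esub>g\<in>G. c g \<otimes>\<^bsub>S\<^esub> g s)"
    using assms(4) by (auto simp: generates_normal_basis_def is_basis_def)
  \<comment> \<open>The function hit by the Galois map is the indicator of the identity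
    automorphism; the \<open>b p\<close> are then expanded in the given normal basis.\<close>
  obtain I :: "('a \<times> 'a) set" and a b where I: "finite I" and a: "a \<in> I \<rightarrow> carrier S" and b: "b \<in> I \<rightarrow> carrier S"
    and ab: "\<And>g. g \<in> G \<Longrightarrow> (\<Oplus>\<^bsub>S\<^esub>p\<in>I. a p \<otimes>\<^bsub>S\<^esub> g (b p)) = delta g"
    using ex_galois_coordinates[OF assms(1), of "\<lambda>g\<in>G. delta g"] by (auto simp: restrict_PiE)
  have "\<forall>p\<in>I. \<exists>c. c \<in> G \<rightarrow> R \<and> b p = (\<Oplus>\<^bsub>S\<^esub>g\<in>G. c g \<otimes>\<^bsub>S\<^esub> g s)"
    using span b by blast
  then obtain c where c: "\<And>p. p \<in> I \<Longrightarrow> c p \<in> G \<rightarrow> R"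
    and bc: "\<And>p. p \<in> I \<Longrightarrow> b p = (\<Oplus>\<^bsub>S\<^esub>g\<in>G. c p g \<otimes>\<^bsub>S\<^esub> g s)"
    by metis
  have "\<exists>t. dual_pair s t"
  proof (rule ex_dual_if_generated[OF s I a])
    fix p assume "p \<in> I"
    then show "c p \<in> carrier \<Gamma> \<rightarrow> carrier S"
      using c RS by (fastforce simp: carrier)
  next
    fix p g h assume "p \<in> I" "g \<in> carrier \<Gamma>" "h \<in> carrier \<Gamma>"
    then show "g (c p h) = c p h"
      using c Rfix by (fastforce simp: carrier)
  next
    fix g assume g: "g \<in> carrier \<Gamma>"
    have "(\<Oplus>\<^bsub>S\<^esub>p\<in>I. a p \<otimes>\<^bsub>S\<^esub> g (\<Oplus>\<^bsub>S\<^esub>h\<in>G. c p h \<otimes>\<^bsub>S\<^esub> h s)) =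
        (\<Oplus>\<^bsub>S\<^esub>p\<in>I. a p \<otimes>\<^bsub>S\<^esub> g (b p))"
      using a b g by (intro finsum_cong') (auto simp: bc[symmetric] Pi_iff)
    then show "(\<Oplus>\<^bsub>S\<^esub>p\<in>I. a p \<otimes>\<^bsub>S\<^esub> g (\<Oplus>\<^bsub>S\<^esub>h\<in>carrier \<Gamma>. c p h \<otimes>\<^bsub>S\<^esub> h s)) = delta g"
      using ab g by (simp add: carrier)
  qed
  then obtain t where "dual_pair s t" ..
  moreover have "odd (order \<Gamma>)"
    using assms(3) by (simp add: order_def carrier)
  ultimately obtain w where dual: "dual_pair w w"
    using dual_pair_self_dual_generator by blast
  have w: "w \<in> carrier S"
    using dual by (simp add: dual_pair_def)
  have Gw: "g x \<in> carrier S" if "g \<in> G" "x \<in> carrier S" for g x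
    using that act_closed by (simp add: carrier)
  \<comment> \<open>Applying \<open>k\<close> permutes the summands of a trace, so the coefficients
    supplied by \<open>dual_pair_expand\<close> do lie in \<open>R\<close>.\<close>
  have trace_R: "galois_trace S G x \<in> R" if x: "x \<in> carrier S" for x
  proof -
    have "k (galois_trace S G x) = galois_trace S G x" if k: "k \<in> G" for k
    proof -
      have kc: "k \<in> carrier \<Gamma>" using k by (simp add: carrier)
      have "k (galois_trace S G x) = (\<Oplus>\<^bsub>S\<^esub>g\<in>carrier \<Gamma>. k (g x))"
        unfolding galois_trace_def carrier[symmetric] using x by (intro act_finsum[OF kc]) auto
      also have "\<dots> = (\<Oplus>\<^bsub>S\<^esub>g\<in>carrier \<Gamma>. (k \<otimes>\<^bsub>\<Gamma>\<^esub> g) x)"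
        using x kc by (intro finsum_cong') (auto simp: act_mult)
      also have "\<dots> = galois_trace S G x"
        unfolding galois_trace_def carrier[symmetric]
        using x by (intro finsum_bij[OF \<Gamma>.bij_betw_mult_left[OF kc]]) auto
      finally show ?thesis .
    qed
    moreover have "galois_trace S G x \<in> carrier S"
      using x Gw by (auto simp: galois_trace_def intro!: finsum_closed)
    ultimately show ?thesis
      by (simp add: R fixed_ring_def)
  qed
  have "generates_normal_basis S R G w"
    unfolding generates_normal_basis_def is_basis_def
  proof (intro conjI ballI impI)
    show "w \<in> carrier S" "(\<lambda>g. g w) \<in> G \<rightarrow> carrier S"
      using w Gw by auto
  next
    fix x assume x: "x \<in> carrier S"
    show "\<exists>c\<in>G \<rightarrow> R. x = (\<Oplus>\<^bsub>S\<^esub>g\<in>G. c g \<otimes>\<^bsub>S\<^esub> g w)"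
    proof
      show "x = (\<Oplus>\<^bsub>S\<^esub>g\<in>G. galois_trace S G (x \<otimes>\<^bsub>S\<^esub> g w) \<otimes>\<^bsub>S\<^esub> g w)"
        using dual_pair_expand[OF dual x] by (simp add: galois_trace_def carrier)
      show "(\<lambda>g. galois_trace S G (x \<otimes>\<^bsub>S\<^esub> g w)) \<in> G \<rightarrow> R"
        using x w Gw by (auto intro!: trace_R)
    qed
  next
    fix c g assume c: "c \<in> G \<rightarrow> R" and g: "g \<in> G"
      and zero: "(\<Oplus>\<^bsub>S\<^esub>g\<in>G. c g \<otimes>\<^bsub>S\<^esub> g w) = \<zero>\<^bsub>S\<^esub>"
    \<comment> \<open>Linear independence: \<open>c g\<close> is the trace of the relation
      multiplied by the conjugate \<open>g w\<close>, and the relation is zero.\<close>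
    have "c g = (\<Oplus>\<^bsub>S\<^esub>k\<in>G. k ((\<Oplus>\<^bsub>S\<^esub>h\<in>G. c h \<otimes>\<^bsub>S\<^esub> h w) \<otimes>\<^bsub>S\<^esub> g w))"
      using trace_coefficient[OF dual, of g c] c g RS Rfix by (auto simp: carrier Pi_iff)
    also have "\<dots> = (\<Oplus>\<^bsub>S\<^esub>k\<in>G. \<zero>\<^bsub>S\<^esub>)"
      unfolding zero using g w Gw act_zero_one(2) by (intro finsum_cong') (auto simp: carrier)
    finally show "c g = \<zero>\<^bsub>S\<^esub>"
      by simp
  qed
  moreover have "galois_trace S G (g w \<otimes>\<^bsub>S\<^esub> h w) = (if g = h then \<one>\<^bsub>S\<^esub> else \<zero>\<^bsub>S\<^esub>)"
    if "g \<in> G" "h \<in> G" for g h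
  proof -
    have gh: "g \<in> carrier \<Gamma>" "h \<in> carrier \<Gamma>" using that by (simp_all add: carrier)
    have "galois_trace S G (g w \<otimes>\<^bsub>S\<^esub> h w) =
        (\<Oplus>\<^bsub>S\<^esub>k\<in>carrier \<Gamma>. (k \<otimes>\<^bsub>\<Gamma>\<^esub> g) w \<otimes>\<^bsub>S\<^esub> (k \<otimes>\<^bsub>\<Gamma>\<^esub> h) w)"
      unfolding galois_trace_def carrier[symmetric]
      using gh w by (intro finsum_cong') (auto simp: act_times act_mult)
    also have "\<dots> = delta (h \<otimes>\<^bsub>\<Gamma>\<^esub> inv\<^bsub>\<Gamma>\<^esub> g)"
      by (rule dual_pair_translate[OF dual gh])
    also have "\<dots> = (if g = h then \<one>\<^bsub>S\<^esub> else \<zero>\<^bsub>S\<^esub>)"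
      using gh \<Gamma>.inv_equality[of h "inv\<^bsub>\<Gamma>\<^esub> g"] by (auto simp: delta_def)
    finally show ?thesis .
  qed
  ultimately show ?thesis
    unfolding generates_self_dual_normal_basis_def by blast
qed

end
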